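(* Let $K/F$ be a cyclic Galois field extension of degree $n$ with ${\rm Gal}(K/F)=\langle\sigma\rangle$, let $R=K[t;\sigma]$ and $x=t^n$, and let $N$ be the reduced norm of the central simple $F(x)$-algebra $K(t;\sigma)$. Let $f(t)=a_0+a_1t+\dots+a_mt^m\in R$ have degree $m$. Then $$N(f(t))=N_{K/F}(a_0)+\dots+(-1)^{m(n-1)}N_{K/F}(a_m)x^m,$$ that is, $N(f)$ is a polynomial in $F[x]$ of degree $m$ with constant term $N_{K/F}(a_0)$ and leading coefficient $(-1)^{m(n-1)}N_{K/F}(a_m)$.
   Context: $K[t;\sigma]$ is the skew polynomial ring of polynomials $\sum a_it^i$, $a_i\in K$, with multiplication determined by $ta=\sigma(a)t$ for $a\in K$. Its center is $F[x]$ with $x=t^n$. The ring of central quotients $K(t;\sigma)=\{f/g : f\in K[t;\sigma],\ 0\neq g\in F[x]\}$ is a central simple algebra of degree $n$ over $F(x)$; it is the cyclic algebra $(K(x),\widetilde{\sigma},x)=\bigoplus_{i=0}^{n-1}K(x)t^i$ with $t^n=x$, where $\widetilde\sigma$ extends $\sigma$ to $K(x)$ by fixing $x$. $N$ denotes its reduced norm, with values in $F(x)$. The degree of $f=a_0+\dots+a_mt^m$ with $a_m\neq0$ is $m$. *)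

theory Defs
  imports
    "HOL-Algebra.Algebraic_Closure_Type"
    "HOL-Library.FuncSet"
    "Jordan_Normal_Form.Determinant"
begin

text \<open>
  A field extension is a field homomorphism \<open>\<iota>\<close> from the ground field into the
  extension field.
\<close>

definition ext_degree :: "('f::field \<Rightarrow> 'k::field) \<Rightarrow> nat" where
  "ext_degree \<iota> = vector_space.dim (\<lambda>c a. \<iota> c * a) (UNIV :: 'k set)"

definition galois_group :: "('f::field \<Rightarrow> 'k::field) \<Rightarrow> ('k \<Rightarrow> 'k) set" where
  "galois_group \<iota> = {\<tau>. field_isom \<tau> \<and> (\<forall>c. \<tau> (\<iota> c) = \<iota> c)}"

text \<open>
  Finite Galois extensions. The library's dimension is \<open>0\<close> for spaces that are not
  finite-dimensional, so \<open>ext_degree \<iota> > 0\<close> says that the extension is finite.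
\<close>

definition finite_galois_extension :: "('f::field \<Rightarrow> 'k::field) \<Rightarrow> bool" where
  "finite_galois_extension \<iota> \<longleftrightarrow>
     field_hom \<iota> \<and> ext_degree \<iota> > 0 \<and> {a. \<forall>\<tau>\<in>galois_group \<iota>. \<tau> a = a} = range \<iota>"

text \<open>
  The Galois group of a finite extension is finite, so the cyclic subgroup generated by
  \<open>\<sigma>\<close> consists of the powers of \<open>\<sigma>\<close> with exponents in the natural numbers.
\<close>

definition cyclic_galois_extension ::
    "('f::field \<Rightarrow> 'k::field) \<Rightarrow> ('k \<Rightarrow> 'k) \<Rightarrow> nat \<Rightarrow> bool" where
  "cyclic_galois_extension \<iota> \<sigma> n \<longleftrightarrow>
     finite_galois_extension \<iota> \<and> ext_degree \<iota> = n \<and>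
     galois_group \<iota> = range (\<lambda>i::nat. \<sigma> ^^ i)"

text \<open>The norm of a finite Galois extension, as an element of the ground field.\<close>

definition field_norm :: "('f::field \<Rightarrow> 'k::field) \<Rightarrow> 'k \<Rightarrow> 'f" where
  "field_norm \<iota> a = (THE c. \<iota> c = (\<Prod>\<tau>\<in>galois_group \<iota>. \<tau> a))"


text \<open>
  The skew polynomial ring. A skew polynomial, with coefficients written on the left, is
  represented by the ordinary polynomial with the same coefficients; only the product
  \<open>(a t\<^sup>i) (b t\<^sup>j) = a \<sigma>\<^sup>i(b) t\<^sup>i\<^sup>+\<^sup>j\<close> differs from the commutative one.
\<close>

definition skew_mult :: "('k::field \<Rightarrow> 'k) \<Rightarrow> 'k poly \<Rightarrow> 'k poly \<Rightarrow> 'k poly" where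
  "skew_mult \<sigma> f g =
     (\<Sum>i\<le>degree f. \<Sum>j\<le>degree g. monom (coeff f i * (\<sigma> ^^ i) (coeff g j)) (i + j))"

definition skew_poly_ring :: "('k::field \<Rightarrow> 'k) \<Rightarrow> 'k poly ring" where
  "skew_poly_ring \<sigma> =
     \<lparr>carrier = UNIV, monoid.mult = skew_mult \<sigma>, one = 1, ring.zero = 0, add = (+)\<rparr>"

lemma skew_mult_t_const:
  "skew_mult \<sigma> (monom 1 1) [:a:] = skew_mult \<sigma> [:\<sigma> a:] (monom 1 1)"
  if "\<sigma> 0 = 0" "\<sigma> 1 = 1"
  using that by (simp add: skew_mult_def degree_monom_eq lessThan_Suc_atMost [symmetric])

text \<open>The embedding of \<open>F[x]\<close> into the skew polynomial ring with \<open>x = t\<^sup>n\<close>.\<close>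

definition center_emb :: "('f::field \<Rightarrow> 'k::field) \<Rightarrow> nat \<Rightarrow> 'f poly \<Rightarrow> 'k poly" where
  "center_emb \<iota> n p = (\<Sum>i\<le>degree p. monom (\<iota> (coeff p i)) (n * i))"


text \<open>
  The ring of central quotients \<open>K(t;\<sigma>)\<close>: equivalence classes of pairs \<open>(f, g)\<close>,
  standing for \<open>f/g\<close>, with \<open>f\<close> a skew polynomial and \<open>g\<close> a nonzero element of \<open>F[x]\<close>.
\<close>

definition quot_rel ::
    "('f::field \<Rightarrow> 'k::field) \<Rightarrow> ('k \<Rightarrow> 'k) \<Rightarrow> nat \<Rightarrow> (('k poly \<times> 'f poly) \<times> ('k poly \<times> 'f poly)) set" where
  "quot_rel \<iota> \<sigma> n = {((f, g), (f', g')). g \<noteq> 0 \<and> g' \<noteq> 0 \<and>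
     skew_mult \<sigma> f (center_emb \<iota> n g') = skew_mult \<sigma> f' (center_emb \<iota> n g)}"

definition quot ::
    "('f::field \<Rightarrow> 'k::field) \<Rightarrow> ('k \<Rightarrow> 'k) \<Rightarrow> nat \<Rightarrow> 'k poly \<Rightarrow> 'f poly \<Rightarrow> ('k poly \<times> 'f poly) set" where
  "quot \<iota> \<sigma> n f g = quot_rel \<iota> \<sigma> n `` {(f, g)}"

definition central_quotients ::
    "('f::field \<Rightarrow> 'k::field) \<Rightarrow> ('k \<Rightarrow> 'k) \<Rightarrow> nat \<Rightarrow> ('k poly \<times> 'f poly) set ring" where
  "central_quotients \<iota> \<sigma> n =
     \<lparr>carrier = (UNIV \<times> {g. g \<noteq> 0}) // quot_rel \<iota> \<sigma> n,
      monoid.mult = (\<lambda>P Q. \<Union>(f, g)\<in>P. \<Union>(f', g')\<in>Q. quot \<iota> \<sigma> n (skew_mult \<sigma> f f') (g * g')),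
      one = quot \<iota> \<sigma> n 1 1,
      ring.zero = quot \<iota> \<sigma> n 0 1,
      add = (\<lambda>P Q. \<Union>(f, g)\<in>P. \<Union>(f', g')\<in>Q.
        quot \<iota> \<sigma> n
          (skew_mult \<sigma> f (center_emb \<iota> n g') + skew_mult \<sigma> f' (center_emb \<iota> n g)) (g * g'))\<rparr>"

text \<open>
  The \<open>F(x)\<close>-algebra structure of \<open>K(t;\<sigma>)\<close>. All the classes in the union coincide,
  by independence of the representation of \<open>q\<close> as a fraction.
\<close>

definition quot_scalar ::
    "('f::field \<Rightarrow> 'k::field) \<Rightarrow> ('k \<Rightarrow> 'k) \<Rightarrow> nat \<Rightarrow> 'f poly fract \<Rightarrow> ('k poly \<times> 'f poly) set" where
  "quot_scalar \<iota> \<sigma> n q =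
     (\<Union>(p, g)\<in>{(p, g). g \<noteq> 0 \<and> q = Fract p g}. quot \<iota> \<sigma> n (center_emb \<iota> n p) g)"


text \<open>
  Let \<open>A\<close> be a \<open>k\<close>-algebra with structure map \<open>s\<close> and let \<open>L\<close> be the algebraic closure
  of \<open>k\<close>. The predicate says that \<open>\<phi>\<close> is a \<open>k\<close>-algebra homomorphism from \<open>A\<close> to the
  \<open>n \<times> n\<close> matrices over \<open>L\<close> whose \<open>L\<close>-linear extension to the tensor product
  \<open>A \<otimes>\<^sub>k L\<close> is an isomorphism: it takes a \<open>k\<close>-basis \<open>B\<close> of \<open>A\<close> to an \<open>L\<close>-basis of the
  matrix algebra.
\<close>

definition splitting ::
    "('a, 'b) ring_scheme \<Rightarrow> ('k::field \<Rightarrow> 'a) \<Rightarrow> nat \<Rightarrow> ('a \<Rightarrow> 'k alg_closure mat) \<Rightarrow> bool" where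
  "splitting A s n \<phi> \<longleftrightarrow>
     (let M = ring_mat TYPE('k alg_closure) n () in
      \<phi> \<in> Ring.ring_hom A M \<and>
      (\<forall>c. \<phi> (s c) = to_ac c \<cdot>\<^sub>m 1\<^sub>m n) \<and>
      (\<exists>B. finite B \<and> B \<subseteq> carrier A \<and>
         (\<forall>a\<in>carrier A. \<exists>!c. c \<in> B \<rightarrow>\<^sub>E UNIV \<and> a = (\<Oplus>\<^bsub>A\<^esub>b\<in>B. s (c b) \<otimes>\<^bsub>A\<^esub> b)) \<and>
         (\<forall>U\<in>carrier M. \<exists>!c. c \<in> B \<rightarrow>\<^sub>E UNIV \<and> U = (\<Oplus>\<^bsub>M\<^esub>b\<in>B. c b \<cdot>\<^sub>m \<phi> b))))"

text \<open>
  The reduced norm of a central simple \<open>k\<close>-algebra of degree \<open>n\<close>: the element of \<open>k\<close>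
  that is the determinant of the image of \<open>a \<otimes> 1\<close> under an isomorphism of
  \<open>A \<otimes>\<^sub>k L\<close> with the \<open>n \<times> n\<close> matrices over \<open>L\<close>. By the Skolem-Noether theorem, it
  does not depend on the isomorphism; the existence of \<open>\<phi>\<close> forces \<open>A\<close> to be central
  simple of degree \<open>n\<close>.
\<close>

definition reduced_norm ::
    "('a, 'b) ring_scheme \<Rightarrow> ('k::field \<Rightarrow> 'a) \<Rightarrow> nat \<Rightarrow> 'a \<Rightarrow> 'k" where
  "reduced_norm A s n a = (THE c. \<exists>\<phi>. splitting A s n \<phi> \<and> to_ac c = det (\<phi> a))"

end

theory Submission
  imports Defs "HOL-Number_Theory.Cong" "Jordan_Normal_Form.Char_Poly"
begin

text \<open>
  Let \<open>y\<close> be an \<open>n\<close>-th root of \<open>x\<close> in the algebraic closure \<open>L\<close> of \<open>F(x)\<close>. Letting \<open>K\<close> act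
  on the \<open>F\<close>-space \<open>K\<close> by multiplication and \<open>t\<close> by \<open>y \<sigma>\<close> gives a representation of
  \<open>K(t;\<sigma>)\<close> by \<open>n \<times> n\<close> matrices over \<open>L\<close>, and it is a splitting, because by Dedekind's
  independence of automorphisms the operators \<open>b\<^sub>j \<sigma>\<^sup>i\<close>, for a basis \<open>(b\<^sub>j)\<close> of \<open>K\<close> over \<open>F\<close>, are a
  basis of the endomorphisms of \<open>K\<close>. By the Skolem-Noether theorem for matrix algebras every
  splitting gives the same determinant, so \<open>N(f)\<close> is the determinant of \<open>\<Sum>\<^sub>k a\<^sub>k \<sigma>\<^sup>k T\<^sup>k\<close>
  at \<open>T = y\<close>. After base change to \<open>K\<close> this operator becomes the matrix whose entry at \<open>(i, j)\<close>
  is the sum of \<open>\<sigma>\<^sup>i(a\<^sub>k) T\<^sup>k\<close> over \<open>k \<equiv> j - i\<close> modulo \<open>n\<close>. In the Leibniz formula the exponents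
  of \<open>T\<close> are therefore divisible by \<open>n\<close>, the constant term is the determinant of a diagonal matrix,
  and the top coefficient that of a diagonal matrix times the \<open>m\<close>-th power of a cyclic shift of
  determinant \<open>(-1)\<^sup>n\<^sup>-\<^sup>1\<close>.
\<close>

section \<open>Cyclic Galois extensions\<close>

text \<open>Induction on the set of characters. Subtracting \<open>\<chi>\<^sub>0 b\<close> times
  the relation at \<open>a\<close> from the relation at \<open>b * a\<close> removes
  \<open>\<chi>\<^sub>0\<close>. The other coefficients become
  \<open>c \<chi> * (\<chi> b - \<chi>\<^sub>0 b)\<close>, and \<open>b\<close> may be chosen with
  \<open>\<chi> b\<close> different from \<open>\<chi>\<^sub>0 b\<close>.\<close>

lemma dedekind_independence:
  fixes S :: "('a::monoid_mult \<Rightarrow> 'b::idom) set"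
  assumes "finite S"
    and "\<And>\<chi>. \<chi> \<in> S \<Longrightarrow> \<chi> 1 = 1"
    and "\<And>\<chi> a b. \<chi> \<in> S \<Longrightarrow> \<chi> (a * b) = \<chi> a * \<chi> b"
    and "\<And>a. (\<Sum>\<chi>\<in>S. c \<chi> * \<chi> a) = 0"
    and "\<chi> \<in> S"
  shows "c \<chi> = 0"
  using assms
proof (induction S arbitrary: c \<chi> rule: finite_induct)
  case empty
  then show ?case by simp
next
  case (insert \<chi>\<^sub>0 S)
  have sum0: "c \<chi>\<^sub>0 * \<chi>\<^sub>0 a + (\<Sum>\<chi>\<in>S. c \<chi> * \<chi> a) = 0" for a
    using insert.prems(3)[of a] insert.hyps by simp
  have S0: "c \<chi> = 0" if \<chi>: "\<chi> \<in> S" for \<chi>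
  proof -
    have "\<exists>b. \<chi> b \<noteq> \<chi>\<^sub>0 b"
      using \<chi> insert.hyps by (metis ext)
    then obtain b where b: "\<chi> b \<noteq> \<chi>\<^sub>0 b" by blast
    have "(\<Sum>\<chi>\<in>S. (c \<chi> * (\<chi> b - \<chi>\<^sub>0 b)) * \<chi> a) = 0" for a
    proof -
      have "(\<Sum>\<chi>\<in>S. (c \<chi> * (\<chi> b - \<chi>\<^sub>0 b)) * \<chi> a)
          = (\<Sum>\<chi>\<in>S. c \<chi> * \<chi> (b * a)) - \<chi>\<^sub>0 b * (\<Sum>\<chi>\<in>S. c \<chi> * \<chi> a)"
        unfolding sum_distrib_left sum_subtractf [symmetric]
        by (rule sum.cong) (auto simp: insert.prems(2) algebra_simps)
      also have "\<dots> = (c \<chi>\<^sub>0 * \<chi>\<^sub>0 (b * a) + (\<Sum>\<chi>\<in>S. c \<chi> * \<chi> (b * a)))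
          - \<chi>\<^sub>0 b * (c \<chi>\<^sub>0 * \<chi>\<^sub>0 a + (\<Sum>\<chi>\<in>S. c \<chi> * \<chi> a))"
        by (simp add: insert.prems(2) algebra_simps)
      also have "\<dots> = 0" by (simp only: sum0) simp
      finally show ?thesis .
    qed
    then have "c \<chi> * (\<chi> b - \<chi>\<^sub>0 b) = 0"
      by (intro insert.IH[where c = "\<lambda>\<chi>. c \<chi> * (\<chi> b - \<chi>\<^sub>0 b)"])
        (use insert.prems \<chi> in auto)
    then show ?thesis using b by simp
  qed
  moreover have "c \<chi>\<^sub>0 = 0"
    using sum0[of 1] S0 insert.prems(1)[of \<chi>\<^sub>0] by simp
  ultimately show ?case using insert.prems(4) by blast
qed

text \<open>The \<open>m\<close> equations are padded with zero rows to a square system. Row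
  \<open>m\<close> is zero, so the determinant vanishes and the kernel is nontrivial.\<close>

lemma homogeneous_system_nontrivial:
  fixes A :: "nat \<Rightarrow> nat \<Rightarrow> 'a::field"
  assumes "m < N"
  obtains v where "\<exists>j<N. v j \<noteq> 0" "\<And>i. i < m \<Longrightarrow> (\<Sum>j<N. A i j * v j) = 0"
proof -
  define B where "B = mat N N (\<lambda>(i, j). if i < m then A i j else 0)"
  have B: "B \<in> carrier_mat N N" by (simp add: B_def)
  \<comment> \<open>The zero row of \<open>B\<close> is a zero column of the transpose, which
    therefore kills the corresponding unit vector.\<close>
  have "transpose_mat B *\<^sub>v unit_vec N m = 0\<^sub>v N"
    using assms by (intro eq_vecI) (auto simp: B_def scalar_prod_def intro!: sum.neutral)
  moreover have "unit_vec N m \<noteq> (0\<^sub>v N :: 'a vec)"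
    using assms by (metis index_unit_vec(1) index_zero_vec(1) zero_neq_one)
  ultimately have "det (transpose_mat B) = 0"
    using B by (subst det_0_iff_vec_prod_zero_field[of _ N]) (auto intro!: exI[of _ "unit_vec N m"])
  then have "det B = 0" using det_transpose[OF B] by simp
  then obtain w where w: "w \<in> carrier_vec N" "w \<noteq> 0\<^sub>v N" "B *\<^sub>v w = 0\<^sub>v N"
    using det_0_iff_vec_prod_zero_field[OF B] by blast
  have "(\<Sum>j<N. A i j * w $ j) = 0" if "i < m" for i
  proof -
    have "(B *\<^sub>v w) $ i = (\<Sum>j<N. A i j * w $ j)"
      using that assms w(1) by (auto simp: B_def scalar_prod_def lessThan_atLeast0 intro!: sum.cong)
    then show ?thesis using w(3) that assms by simp
  qed
  moreover have "\<exists>j<N. w $ j \<noteq> 0"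
    using w(1,2) by (metis carrier_vecD eq_vecI index_zero_vec(1) index_zero_vec(2))
  ultimately show ?thesis by (intro that[of "\<lambda>j. w $ j"]) auto
qed

lemma funpow_field_hom:
  fixes \<sigma> :: "'k::field \<Rightarrow> 'k"
  assumes "field_hom \<sigma>"
  shows "field_hom (\<sigma> ^^ i)"
proof (induction i)
  case 0
  show ?case by unfold_locales auto
next
  case (Suc i)
  interpret s: field_hom \<sigma> by fact
  interpret si: field_hom "\<sigma> ^^ i" by fact
  show ?case by unfold_locales (auto simp: s.hom_add s.hom_mult si.hom_add si.hom_mult)
qed

lemma dedekind_funpow:
  fixes \<sigma> :: "'k::field \<Rightarrow> 'k"
  assumes "field_hom \<sigma>" "inj_on (\<lambda>i. \<sigma> ^^ i) {..<d}"
    and "\<And>a. (\<Sum>i<d. c i * (\<sigma> ^^ i) a) = 0" and "i < d"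
  shows "c i = 0"
proof -
  \<comment> \<open>Dedekind's lemma speaks of a set of characters, so coefficients indexed by
    exponents are carried over along the inverse of the injective map from exponents to
    powers.\<close>
  let ?S = "(\<lambda>i. \<sigma> ^^ i) ` {..<d}"
  let ?j = "the_inv_into {..<d} (\<lambda>i. \<sigma> ^^ i)"
  have "c (?j (\<sigma> ^^ i)) = 0"
  proof (rule dedekind_independence[where S = ?S and c = "\<lambda>\<chi>. c (?j \<chi>)"])
    show "(\<Sum>\<chi>\<in>?S. c (?j \<chi>) * \<chi> a) = 0" for a
      using assms(3)[of a]
      by (subst sum.reindex[OF assms(2)]) (simp add: the_inv_into_f_f[OF assms(2)])
  next
    fix \<chi> :: "'k \<Rightarrow> 'k" and a b assume "\<chi> \<in> ?S"
    then obtain j where j: "\<chi> = \<sigma> ^^ j" by blast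
    interpret field_hom \<chi> unfolding j by (rule funpow_field_hom[OF assms(1)])
    show "\<chi> 1 = 1" "\<chi> (a * b) = \<chi> a * \<chi> b" by (simp_all add: hom_mult)
  qed (use assms(4) in auto)
  then show ?thesis using the_inv_into_f_f[OF assms(2)] assms(4) by simp
qed

section \<open>Cyclic extensions in coordinates\<close>

text \<open>\<open>b\<close> is a basis of K over F and \<open>crd\<close> its coordinate
  functionals. \<open>W\<close> is the inverse of the Dedekind matrix with entries
  \<open>(\<sigma> ^^ i) (b q)\<close>; \<open>VW\<close> and \<open>WV\<close> are the two orders
  of the product.\<close>

locale cyclic_data =
  fixes \<iota> :: "'f::field \<Rightarrow> 'k::field" and \<sigma> :: "'k \<Rightarrow> 'k" and n :: nat
    and b :: "nat \<Rightarrow> 'k" and crd :: "nat \<Rightarrow> 'k \<Rightarrow> 'f" and W :: "nat \<Rightarrow> nat \<Rightarrow> 'k"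
  assumes hom_\<iota>: "field_hom \<iota>" and hom_\<sigma>: "field_hom \<sigma>" and n_pos: "0 < n"
    and \<sigma>_\<iota>: "\<sigma> (\<iota> c) = \<iota> c" and \<sigma>_n: "(\<sigma> ^^ n) a = a"
    and crd_add: "crd j (u + v) = crd j u + crd j v"
    and crd_scale: "crd j (\<iota> c * u) = c * crd j u"
    and crd_basis: "j < n \<Longrightarrow> k < n \<Longrightarrow> crd j (b k) = (if j = k then 1 else 0)"
    and expand: "(\<Sum>j<n. \<iota> (crd j u) * b j) = u"
    and VW: "i < n \<Longrightarrow> k < n \<Longrightarrow> (\<Sum>q<n. (\<sigma> ^^ i) (b q) * W q k) = (if i = k then 1 else 0)"
    and WV: "p < n \<Longrightarrow> q < n \<Longrightarrow> (\<Sum>i<n. W p i * (\<sigma> ^^ i) (b q)) = (if p = q then 1 else 0)"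
    and norm: "\<iota> (field_norm \<iota> a) = (\<Prod>i<n. (\<sigma> ^^ i) a)"

lemma finite_extension_basis:
  fixes \<iota> :: "'f::field \<Rightarrow> 'k::field"
  assumes "field_hom \<iota>" and "ext_degree \<iota> = n" and "0 < n"
  obtains b :: "nat \<Rightarrow> 'k" and crd :: "nat \<Rightarrow> 'k \<Rightarrow> 'f" where
    "\<And>j u v. crd j (u + v) = crd j u + crd j v"
    "\<And>j c u. crd j (\<iota> c * u) = c * crd j u"
    "\<And>j k. j < n \<Longrightarrow> k < n \<Longrightarrow> crd j (b k) = (if j = k then 1 else 0)"
    "\<And>u. (\<Sum>j<n. \<iota> (crd j u) * b j) = u"
proof -
  interpret i: field_hom \<iota> by fact
  interpret V: vector_space "\<lambda>c a. \<iota> c * a"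
    by unfold_locales (auto simp: algebra_simps i.hom_add i.hom_mult)
  obtain B where B: "V.independent B" "UNIV \<subseteq> V.span B" "card B = n"
    using V.basis_exists[of UNIV] assms(2) unfolding ext_degree_def by metis
  \<comment> \<open>An infinite set has cardinality 0, so a positive dimension makes the basis
    finite.\<close>
  then have "finite B" using assms(3) card_gt_0_iff by metis
  then obtain b where b: "bij_betw b {..<n} B"
    using ex_bij_betw_nat_finite[of B] B(3) by (metis lessThan_atLeast0)
  have inB: "b j \<in> B" if "j < n" for j using b that by (auto simp: bij_betw_def)
  have sp: "v \<in> V.span B" for v using B(2) by auto
  show ?thesis
  proof (rule that[of "\<lambda>j v. V.representation B v (b j)" b])
    show "V.representation B (u + v) (b j) = V.representation B u (b j) + V.representation B v (b j)" for j u v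
      using V.representation_add[OF B(1) sp sp] by metis
    show "V.representation B (\<iota> c * u) (b j) = c * V.representation B u (b j)" for j c u
      using V.representation_scale[OF B(1) sp] by metis
    show "V.representation B (b k) (b j) = (if j = k then 1 else 0)" if "j < n" "k < n" for j k
      using V.representation_basis[OF B(1) inB[OF that(2)]] b that
      by (auto simp: bij_betw_def inj_on_def)
    show "(\<Sum>j<n. \<iota> (V.representation B u (b j)) * b j) = u" for u
    proof -
      have "(\<Sum>j<n. \<iota> (V.representation B u (b j)) * b j) = (\<Sum>v\<in>B. \<iota> (V.representation B u v) * v)"
        by (rule sum.reindex_bij_betw[OF b])
      also have "\<dots> = u"
        by (rule V.sum_representation_eq[OF B(1) sp \<open>finite B\<close>]) auto
      finally show ?thesis .
    qed
  qed
qed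

lemma cyclic_galois_extensionD:
  assumes "cyclic_galois_extension \<iota> \<sigma> n"
  shows "field_hom \<iota>" "ext_degree \<iota> = n" "0 < n" "field_hom \<sigma>" "\<sigma> (\<iota> c) = \<iota> c"
    "galois_group \<iota> = range (\<lambda>i. \<sigma> ^^ i)"
    "\<sigma> a = a \<Longrightarrow> a \<in> range \<iota>"
proof -
  note A = assms[unfolded cyclic_galois_extension_def finite_galois_extension_def]
  show "field_hom \<iota>" "ext_degree \<iota> = n" "0 < n" and G: "galois_group \<iota> = range (\<lambda>i. \<sigma> ^^ i)"
    using A by auto
  have "\<sigma> \<in> galois_group \<iota>" unfolding G by (rule range_eqI[of _ _ 1]) simp
  then show "field_hom \<sigma>" "\<sigma> (\<iota> c) = \<iota> c"
    unfolding galois_group_def by (auto intro: field_isom.axioms)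
  \<comment> \<open>What the generator fixes is fixed by the whole Galois group and hence lies in
    F.\<close>
  have "(\<sigma> ^^ i) a = a" if "\<sigma> a = a" for i by (induction i) (use that in auto)
  then show "a \<in> range \<iota>" if "\<sigma> a = a"
    using A that unfolding G by auto
qed

text \<open>This is Artin's comparison of the degree \<open>n\<close> with the order
  \<open>d\<close> of \<open>\<sigma>\<close>: Dedekind's independence bounds \<open>d\<close> by
  \<open>n\<close>, and a trace argument over the fixed field bounds \<open>n\<close> by
  \<open>d\<close>.\<close>

lemma cyclic_galois_order:
  fixes \<iota> :: "'f::field \<Rightarrow> 'k::field"
  assumes "cyclic_galois_extension \<iota> \<sigma> n"
  shows "\<sigma> ^^ n = id" "inj_on (\<lambda>i. \<sigma> ^^ i) {..<n}"
proof -
  note D = cyclic_galois_extensionD[OF assms]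
  obtain b crd where basis:
    "\<And>j u v. crd j (u + v) = crd j u + crd j v"
    "\<And>j c u. crd j (\<iota> c * u) = c * crd j u"
    "\<And>j k. j < n \<Longrightarrow> k < n \<Longrightarrow> crd j (b k) = (if j = k then 1 else (0::'f))"
    "\<And>u. (\<Sum>j<n. \<iota> (crd j u) * b j) = u"
    by (rule finite_extension_basis[OF D(1,2,3)]) (rule that)
  interpret s: field_hom \<sigma> by (rule D(4))
  interpret i: field_hom \<iota> by (rule D(1))
  interpret sp: field_hom "\<sigma> ^^ k" for k by (rule funpow_field_hom[OF D(4)])
  have \<sigma>\<iota>: "(\<sigma> ^^ k) (\<iota> c) = \<iota> c" for k c by (induction k) (auto simp: D(5))
  \<comment> \<open>The powers of \<open>\<sigma>\<close> are F-linear, so a relation between them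
    can be tested on the basis.\<close>
  have vanish: "(\<Sum>i<d. v i * (\<sigma> ^^ i) a) = 0"
    if "\<And>j. j < n \<Longrightarrow> (\<Sum>i<d. v i * (\<sigma> ^^ i) (b j)) = 0" for v :: "nat \<Rightarrow> 'k" and d a
  proof -
    have "(\<Sum>i<d. v i * (\<sigma> ^^ i) a) = (\<Sum>i<d. v i * (\<Sum>j<n. \<iota> (crd j a) * (\<sigma> ^^ i) (b j)))"
      by (subst (1) basis(4)[of a, symmetric]) (simp add: sp.hom_sum sp.hom_mult \<sigma>\<iota>)
    also have "\<dots> = (\<Sum>j<n. \<iota> (crd j a) * (\<Sum>i<d. v i * (\<sigma> ^^ i) (b j)))"
      unfolding sum_distrib_left by (subst sum.swap) (simp add: mult.left_commute)
    finally show ?thesis using that by simp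
  qed
  \<comment> \<open>With more than \<open>n\<close> distinct powers, the \<open>n\<close> equations
    given by the basis would have a nontrivial solution, that is, a relation between distinct
    automorphisms.\<close>
  have le: "d \<le> n" if inj: "inj_on (\<lambda>i. \<sigma> ^^ i) {..<d}" for d
  proof (rule ccontr)
    assume "\<not> d \<le> n"
    then obtain v where v: "\<exists>i<d. v i \<noteq> 0" "\<And>j. j < n \<Longrightarrow> (\<Sum>i<d. (\<sigma> ^^ i) (b j) * v i) = 0"
      using homogeneous_system_nontrivial[of n d "\<lambda>j i. (\<sigma> ^^ i) (b j)"] by auto
    have "v i = 0" if "i < d" for i
      by (rule dedekind_funpow[OF D(4) inj _ that]) (rule vanish, use v(2) in \<open>simp add: mult.commute\<close>)
    then show False using v(1) by blast
  qed
  have inj\<sigma>: "inj (\<sigma> ^^ k)" for k by (rule injI) simp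
  \<comment> \<open>Two of the first \<open>n + 1\<close> powers coincide; cancelling the smaller
    one shows that \<open>\<sigma>\<close> has finite order.\<close>
  have "\<not> inj_on (\<lambda>i. \<sigma> ^^ i) {..<Suc n}" using le[of "Suc n"] by auto
  then obtain i j where ij: "i < j" "\<sigma> ^^ i = \<sigma> ^^ j"
    unfolding inj_on_def by (metis linorder_neqE_nat)
  have "\<sigma> ^^ (j - i) = id"
  proof
    fix a
    have "(\<sigma> ^^ i) ((\<sigma> ^^ (j - i)) a) = (\<sigma> ^^ i) a"
      using ij by (metis comp_apply funpow_add le_add_diff_inverse less_imp_le)
    then show "(\<sigma> ^^ (j - i)) a = id a" by simp
  qed
  then have ex: "\<exists>d. 0 < d \<and> \<sigma> ^^ d = id" using ij(1) by (metis zero_less_diff)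
  define d where "d = (LEAST d. 0 < d \<and> \<sigma> ^^ d = id)"
  have d: "0 < d" "\<sigma> ^^ d = id" using LeastI_ex[OF ex] by (auto simp: d_def)
  have min: "\<sigma> ^^ k \<noteq> id" if "0 < k" "k < d" for k
    using that not_less_Least[of k] unfolding d_def by blast
  have injd: "inj_on (\<lambda>i. \<sigma> ^^ i) {..<d}"
  proof (rule linorder_inj_onI)
    fix i j assume "i < j" and ij: "i \<in> {..<d}" "j \<in> {..<d}"
    show "\<sigma> ^^ i \<noteq> \<sigma> ^^ j"
    proof
      assume eq: "\<sigma> ^^ i = \<sigma> ^^ j"
      have "\<sigma> ^^ (j - i) = id"
      proof
        fix a
        have "(\<sigma> ^^ i) ((\<sigma> ^^ (j - i)) a) = (\<sigma> ^^ i) a"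
          using \<open>i < j\<close> eq by (metis comp_apply funpow_add le_add_diff_inverse less_imp_le)
        then show "(\<sigma> ^^ (j - i)) a = id a" by simp
      qed
      then show False using min[of "j - i"] \<open>i < j\<close> ij less_imp_diff_less[of j d i] by simp
    qed
  qed auto
  \<comment> \<open>If \<open>d < n\<close>, the conjugates of the basis satisfy a common relation
    \<open>v\<close>. Averaging it over the powers of \<open>\<sigma>\<close> produces a relation
    with coefficients in F, against the independence of the basis.\<close>
  have "n \<le> d"
  proof (rule ccontr)
    assume "\<not> n \<le> d"
    then obtain v where v: "\<exists>j<n. v j \<noteq> 0" "\<And>i. i < d \<Longrightarrow> (\<Sum>j<n. (\<sigma> ^^ i) (b j) * v j) = 0"
      using homogeneous_system_nontrivial[of d n "\<lambda>i j. (\<sigma> ^^ i) (b j)"] by auto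
    obtain j0 where j0: "j0 < n" "v j0 \<noteq> 0" using v(1) by blast
    \<comment> \<open>By Dedekind, the sum of the distinct powers is not the zero map, so some
      element has nonzero trace.\<close>
    have "\<exists>z. (\<Sum>i<d. (\<sigma> ^^ i) z) \<noteq> 0"
      using dedekind_funpow[OF D(4) injd, of "\<lambda>_. 1" 0] d(1) by auto
    then obtain z where z: "(\<Sum>i<d. (\<sigma> ^^ i) z) \<noteq> 0" by blast
    \<comment> \<open>The scaling makes \<open>w j0\<close> equal to \<open>z\<close>, whose trace
      is nonzero.\<close>
    define w where "w j = z / v j0 * v j" for j
    define tr where "tr a = (\<Sum>i<d. (\<sigma> ^^ i) a)" for a
    have w: "(\<Sum>j<n. (\<sigma> ^^ i) (b j) * w j) = 0" if "i < d" for i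
    proof -
      have "(\<Sum>j<n. (\<sigma> ^^ i) (b j) * w j) = z / v j0 * (\<Sum>j<n. (\<sigma> ^^ i) (b j) * v j)"
        unfolding w_def sum_distrib_left by (rule sum.cong) auto
      then show ?thesis using v(2)[OF that] by simp
    qed
    have w': "(\<Sum>j<n. b j * (\<sigma> ^^ i) (w j)) = 0" if "i < d" for i
    proof (cases "i = 0")
      case True
      then show ?thesis using w[of 0] d(1) by simp
    next
      case False
      \<comment> \<open>Applying \<open>\<sigma> ^^ i\<close> to equation \<open>d - i\<close> moves
        the automorphism from the basis to the coefficients. The case \<open>i = 0\<close> is
        separate because \<open>d - 0\<close> is not an index below \<open>d\<close>.\<close>
      have "0 = (\<sigma> ^^ i) (\<Sum>j<n. (\<sigma> ^^ (d - i)) (b j) * w j)" using w[of "d - i"] that False by simp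
      also have "\<dots> = (\<Sum>j<n. (\<sigma> ^^ i) ((\<sigma> ^^ (d - i)) (b j)) * (\<sigma> ^^ i) (w j))"
        by (simp add: sp.hom_sum sp.hom_mult)
      also have "\<dots> = (\<Sum>j<n. b j * (\<sigma> ^^ i) (w j))"
      proof -
        have "(\<sigma> ^^ i) ((\<sigma> ^^ (d - i)) a) = a" for a
          using d(2) that by (metis comp_apply funpow_add id_apply le_add_diff_inverse less_imp_le)
        then show ?thesis by simp
      qed
      finally show ?thesis by simp
    qed
    have tr_fix: "\<sigma> (tr a) = tr a" for a
    proof -
      have "\<sigma> (tr a) = (\<Sum>i<d. (\<sigma> ^^ Suc i) a)" by (simp add: tr_def s.hom_sum)
      \<comment> \<open>Both sides are the sum of all \<open>(\<sigma> ^^ i) a\<close> with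
        \<open>i\<close> from 0 to \<open>d\<close>, once split at the first term and once at the
        last.\<close>
      moreover have "(\<Sum>i<d. (\<sigma> ^^ Suc i) a) + (\<sigma> ^^ 0) a = tr a + (\<sigma> ^^ d) a"
        unfolding tr_def using sum.lessThan_Suc_shift[of "\<lambda>i. (\<sigma> ^^ i) a" d]
          sum.lessThan_Suc[of "\<lambda>i. (\<sigma> ^^ i) a" d] by (simp add: add.commute)
      ultimately show ?thesis using d(2) by simp
    qed
    define c where "c j = inv_into UNIV \<iota> (tr (w j))" for j
    have c: "tr (w j) = \<iota> (c j)" for j
      unfolding c_def by (rule f_inv_into_f[OF D(7)[OF tr_fix], symmetric])
    have zero: "(\<Sum>j<n. \<iota> (c j) * b j) = 0"
    proof -
      have "(\<Sum>j<n. \<iota> (c j) * b j) = (\<Sum>j<n. \<Sum>i<d. b j * (\<sigma> ^^ i) (w j))"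
        unfolding c[symmetric] tr_def sum_distrib_left sum_distrib_right by (simp add: mult.commute)
      also have "\<dots> = 0" by (subst sum.swap) (simp add: w')
      finally show ?thesis .
    qed
    have crd0: "crd j 0 = 0" for j using basis(2)[of j 0 0] by simp
    have crd_sum: "crd j (sum g A) = (\<Sum>a\<in>A. crd j (g a))" for j and g :: "nat \<Rightarrow> 'k" and A
      by (induction A rule: infinite_finite_induct) (auto simp: crd0 basis(1))
    have "crd j0 (\<Sum>j<n. \<iota> (c j) * b j) = (\<Sum>j<n. c j * (if j0 = j then 1 else 0))"
      unfolding crd_sum basis(2) using basis(3) j0(1) by (intro sum.cong) auto
    then have "c j0 = 0" unfolding zero crd0 using j0(1) by (simp add: if_distrib sum.delta cong: if_cong)
    then have "tr (w j0) = 0" using c by simp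
    then show False using z j0(2) by (simp add: tr_def w_def)
  qed
  with le[OF injd] have "d = n" by simp
  then show "\<sigma> ^^ n = id" "inj_on (\<lambda>i. \<sigma> ^^ i) {..<n}" using d injd by auto
qed

text \<open>A kernel vector of the transposed Dedekind matrix is a relation between the first
  \<open>n\<close> powers of \<open>\<sigma>\<close> on the basis, hence on all of K, so Dedekind
  makes the matrix invertible. The product of all conjugates is fixed by \<open>\<sigma>\<close>, so
  it comes from F.\<close>

lemma cyclic_galois_cyclic_data:
  fixes \<iota> :: "'f::field \<Rightarrow> 'k::field"
  assumes "cyclic_galois_extension \<iota> \<sigma> n"
  obtains b crd W where "cyclic_data \<iota> \<sigma> n b crd W"
proof -
  note D = cyclic_galois_extensionD[OF assms]
  note order = cyclic_galois_order[OF assms]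
  obtain b crd where basis:
    "\<And>j u v. crd j (u + v) = crd j u + crd j v"
    "\<And>j c u. crd j (\<iota> c * u) = c * crd j u"
    "\<And>j k. j < n \<Longrightarrow> k < n \<Longrightarrow> crd j (b k) = (if j = k then 1 else (0::'f))"
    "\<And>u. (\<Sum>j<n. \<iota> (crd j u) * b j) = u"
    by (rule finite_extension_basis[OF D(1,2,3)]) (rule that)
  interpret s: field_hom \<sigma> by (rule D(4))
  interpret i: field_hom \<iota> by (rule D(1))
  interpret sp: field_hom "\<sigma> ^^ k" for k by (rule funpow_field_hom[OF D(4)])
  have \<sigma>\<iota>: "(\<sigma> ^^ k) (\<iota> c) = \<iota> c" for k c by (induction k) (auto simp: D(5))
  define V where "V = mat n n (\<lambda>(i, j). (\<sigma> ^^ i) (b j))"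
  have V: "V \<in> carrier_mat n n" by (simp add: V_def)
  have "det (transpose_mat V) \<noteq> 0"
  proof
    assume "det (transpose_mat V) = 0"
    then obtain v where v: "v \<in> carrier_vec n" "v \<noteq> 0\<^sub>v n" "transpose_mat V *\<^sub>v v = 0\<^sub>v n"
      using det_0_iff_vec_prod_zero_field[of "transpose_mat V" n] V by auto
    have vb: "(\<Sum>i<n. v $ i * (\<sigma> ^^ i) (b j)) = 0" if "j < n" for j
    proof -
      have "(transpose_mat V *\<^sub>v v) $ j = (\<Sum>i<n. v $ i * (\<sigma> ^^ i) (b j))"
        using that v(1) by (auto simp: V_def scalar_prod_def lessThan_atLeast0 mult.commute intro!: sum.cong)
      then show ?thesis using v(3) that by simp
    qed
    have all: "(\<Sum>i<n. v $ i * (\<sigma> ^^ i) a) = 0" for a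
    proof -
      have "(\<Sum>i<n. v $ i * (\<sigma> ^^ i) a) = (\<Sum>i<n. v $ i * (\<Sum>j<n. \<iota> (crd j a) * (\<sigma> ^^ i) (b j)))"
        by (subst (1) basis(4)[of a, symmetric]) (simp add: sp.hom_sum sp.hom_mult \<sigma>\<iota>)
      also have "\<dots> = (\<Sum>j<n. \<iota> (crd j a) * (\<Sum>i<n. v $ i * (\<sigma> ^^ i) (b j)))"
        unfolding sum_distrib_left by (subst sum.swap) (simp add: mult.left_commute)
      finally show ?thesis using vb by simp
    qed
    have "v $ i = 0" if "i < n" for i
      by (rule dedekind_funpow[OF D(4) order(2) all that])
    then have "v = 0\<^sub>v n" using v(1) by (intro eq_vecI) auto
    then show False using v(2) by simp
  qed
  then have "det V \<noteq> 0" using det_transpose[OF V] by simp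
  then obtain W where W: "inverts_mat V W" "inverts_mat W V"
    using det_non_zero_imp_unit[OF V] V by (auto simp: Units_def ring_mat_simps inverts_mat_def)
  then have W': "W \<in> carrier_mat n n" "V * W = 1\<^sub>m n" "W * V = 1\<^sub>m n"
    using V by (auto simp: inverts_mat_def dest: arg_cong[where f = dim_row] arg_cong[where f = dim_col] intro!: carrier_matI)
  have norm: "\<iota> (field_norm \<iota> a) = (\<Prod>i<n. (\<sigma> ^^ i) a)" for a
  proof -
    have G: "galois_group \<iota> = (\<lambda>i. \<sigma> ^^ i) ` {..<n}"
    proof -
      have "\<sigma> ^^ i = \<sigma> ^^ (i mod n)" for i
      proof -
        have "(\<sigma> ^^ n) ^^ k = id" for k by (induction k) (auto simp: order(1))
        then have "\<sigma> ^^ (n * k) = id" for k by (simp add: funpow_mult mult.commute)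
        then show ?thesis by (metis add.commute div_mult_mod_eq funpow_add id_comp mult.commute o_id)
      qed
      then show ?thesis unfolding D(6) using D(3) by (auto simp: image_iff) (metis mod_less_divisor lessThan_iff)
    qed
    have prod: "(\<Prod>\<tau>\<in>galois_group \<iota>. \<tau> a) = (\<Prod>i<n. (\<sigma> ^^ i) a)"
      unfolding G by (subst prod.reindex[OF order(2)]) simp
    have "\<sigma> (\<Prod>i<n. (\<sigma> ^^ i) a) = (\<Prod>i<n. (\<sigma> ^^ i) a)"
    proof -
      have "(\<Prod>i<n. (\<sigma> ^^ i) a) = (\<Prod>i<n. (\<sigma> ^^ Suc i) a)"
      proof (cases "n")
        case (Suc m)
        \<comment> \<open>Replacing each exponent by its successor only trades the factor
          \<open>a\<close> for \<open>(\<sigma> ^^ n) a\<close>, which is \<open>a\<close>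
          again.\<close>
        have "(\<Prod>i<n. (\<sigma> ^^ i) a) = a * (\<Prod>i<m. (\<sigma> ^^ Suc i) a)"
          unfolding Suc by (simp only: prod.lessThan_Suc_shift) simp
        also have "\<dots> = (\<Prod>i<n. (\<sigma> ^^ Suc i) a)"
          using order(1) unfolding Suc by (simp add: mult.commute del: funpow.simps(2))
        finally show ?thesis .
      qed simp
      moreover have "\<sigma> (\<Prod>i<n. (\<sigma> ^^ i) a) = (\<Prod>i<n. (\<sigma> ^^ Suc i) a)"
        by (simp add: s.hom_prod)
      ultimately show ?thesis by (rule trans[OF _ sym, rotated])
    qed
    then obtain c where c: "(\<Prod>i<n. (\<sigma> ^^ i) a) = \<iota> c" using D(7) by blast
    \<comment> \<open>Injectivity of \<open>\<iota>\<close> makes the description in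
      \<open>field_norm\<close> unique.\<close>
    show ?thesis unfolding field_norm_def prod c by simp
  qed
  show ?thesis
  proof (rule that[of b crd "\<lambda>q k. W $$ (q, k)"], unfold_locales)
    show "(\<Sum>q<n. (\<sigma> ^^ i) (b q) * W $$ (q, k)) = (if i = k then 1 else 0)" if "i < n" "k < n" for i k
    proof -
      have "(V * W) $$ (i, k) = (\<Sum>q<n. (\<sigma> ^^ i) (b q) * W $$ (q, k))"
        using that W'(1) V by (auto simp: scalar_prod_def V_def lessThan_atLeast0 intro!: sum.cong)
      then show ?thesis using W' that by simp
    qed
    show "(\<Sum>i<n. W $$ (p, i) * (\<sigma> ^^ i) (b q)) = (if p = q then 1 else 0)" if "p < n" "q < n" for p q
    proof -
      have "(W * V) $$ (p, q) = (\<Sum>i<n. W $$ (p, i) * (\<sigma> ^^ i) (b q))"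
        using that W'(1) V by (auto simp: scalar_prod_def V_def lessThan_atLeast0 intro!: sum.cong)
      then show ?thesis using W' that by simp
    qed
    show "(\<sigma> ^^ n) a = a" for a using order(1) by simp
  qed (use D basis norm in \<open>auto simp: s.hom_add s.hom_mult i.hom_add i.hom_mult\<close>)
qed

section \<open>Determinants of polynomial matrices\<close>

text \<open>This is the substitution \<open>x = T^n\<close> by which F[x] sits inside F[T]. Each
  Horner step shifts the index by \<open>n\<close>, which explains the three ranges of
  \<open>k\<close>.\<close>

lemma coeff_pcompose_monom_one:
  fixes p :: "'a::comm_ring_1 poly"
  assumes "0 < n"
  shows "coeff (pcompose p (monom 1 n)) k = (if n dvd k then coeff p (k div n) else 0)"
proof (induction p arbitrary: k)
  case 0
  then show ?case by simp
next
  case (pCons a p)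
  consider "k = 0" | "0 < k" "k < n" | "n \<le> k" by linarith
  then show ?case
  proof cases
    case 3
    then have "(n dvd k - n) = (n dvd k)" "k div n = Suc ((k - n) div n)"
      using assms by (simp_all add: dvd_minus_self le_div_geq)
    then show ?thesis using 3 assms
      by (auto simp: pcompose_pCons coeff_monom_mult pCons.IH coeff_pCons split: nat.split)
  qed (use assms in \<open>auto simp: pcompose_pCons coeff_monom_mult coeff_pCons split: nat.split\<close>)
qed

text \<open>\<open>a\<close> and \<open>c\<close> are bounds that may fail to be attained, so this
  handles formal leading coefficients, possibly zero, as they occur in the entries of a
  matrix.\<close>

lemma coeff_mult_degree_bound:
  fixes p q :: "'a::comm_ring_1 poly"
  assumes "degree p \<le> a" "degree q \<le> c"
  shows "coeff (p * q) (a + c) = coeff p a * coeff q c"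
proof -
  have "coeff (p * q) (a + c) = (\<Sum>i\<le>a + c. if i = a then coeff p a * coeff q c else 0)"
    unfolding coeff_mult
  proof (rule sum.cong)
    fix i assume "i \<in> {..a + c}"
    consider "i < a" | "i = a" | "a < i" by linarith
    then show "coeff p i * coeff q (a + c - i) = (if i = a then coeff p a * coeff q c else 0)"
      by cases (use assms in \<open>auto simp: coeff_eq_0\<close>)
  qed simp
  then show ?thesis by simp
qed

lemma prod_degree_bound:
  fixes p :: "'b \<Rightarrow> 'a::comm_ring_1 poly"
  assumes "finite S" "\<And>i. i \<in> S \<Longrightarrow> degree (p i) \<le> m"
  shows "degree (\<Prod>i\<in>S. p i) \<le> card S * m"
    and "coeff (\<Prod>i\<in>S. p i) (card S * m) = (\<Prod>i\<in>S. coeff (p i) m)"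
proof -
  have "degree (\<Prod>i\<in>S. p i) \<le> card S * m \<and> coeff (\<Prod>i\<in>S. p i) (card S * m) = (\<Prod>i\<in>S. coeff (p i) m)"
    using assms
  proof (induction S rule: finite_induct)
    case (insert i S)
    then have IH: "degree (\<Prod>i\<in>S. p i) \<le> card S * m" "coeff (\<Prod>i\<in>S. p i) (card S * m) = (\<Prod>i\<in>S. coeff (p i) m)"
      and i: "degree (p i) \<le> m" by auto
    have "degree (p i * (\<Prod>i\<in>S. p i)) \<le> m + card S * m"
      by (rule order_trans[OF degree_mult_le]) (use IH(1) i in simp)
    with coeff_mult_degree_bound[OF i IH(1)] IH(2) insert.hyps show ?case by simp
  qed simp
  then show "degree (\<Prod>i\<in>S. p i) \<le> card S * m"
    "coeff (\<Prod>i\<in>S. p i) (card S * m) = (\<Prod>i\<in>S. coeff (p i) m)" by auto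
qed

lemma coeff_signof_mult: "coeff (signof p * q) k = signof p * coeff (q :: 'a::comm_ring_1 poly) k"
  by (simp add: sign_def)

text \<open>In each Leibniz term, \<open>n\<close> factors of degree at most \<open>m\<close> reach
  exponent \<open>n * m\<close> only through their coefficients at \<open>m\<close>. Collecting
  these gives the Leibniz formula of the coefficient matrix.\<close>

lemma det_degree_bound:
  fixes A :: "'a::idom poly mat"
  assumes A: "A \<in> carrier_mat n n"
    and deg: "\<And>i j. i < n \<Longrightarrow> j < n \<Longrightarrow> degree (A $$ (i, j)) \<le> m"
  shows "degree (det A) \<le> n * m"
    and "coeff (det A) (n * m) = det (map_mat (\<lambda>p. coeff p m) A)"
proof -
  have perm: "p i < n" if "p permutes {0..<n}" "i < n" for p i
    using permutes_in_image[OF that(1), of i] that(2) by simp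
  show "degree (det A) \<le> n * m"
    unfolding det_def'[OF A]
  proof (rule degree_sum_le)
    fix p assume "p \<in> {p. p permutes {0..<n}}"
    then show "degree (signof p * (\<Prod>i = 0..<n. A $$ (i, p i))) \<le> n * m"
      using prod_degree_bound(1)[of "{0..<n}" "\<lambda>i. A $$ (i, p i)" m] deg perm
      by (simp add: degree_signof_mult)
  qed (simp add: finite_permutations)
  have "coeff (det A) (n * m) = (\<Sum>p | p permutes {0..<n}. signof p * (\<Prod>i = 0..<n. coeff (A $$ (i, p i)) m))"
    unfolding det_def'[OF A] coeff_sum coeff_signof_mult
  proof (rule sum.cong)
    fix p assume "p \<in> {p. p permutes {0..<n}}"
    then show "signof p * coeff (\<Prod>i = 0..<n. A $$ (i, p i)) (n * m) = signof p * (\<Prod>i = 0..<n. coeff (A $$ (i, p i)) m)"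
      using prod_degree_bound(2)[of "{0..<n}" "\<lambda>i. A $$ (i, p i)" m] deg perm by simp
  qed simp
  also have "\<dots> = det (map_mat (\<lambda>p. coeff p m) A)"
  proof -
    have M: "map_mat (\<lambda>p. coeff p m) A \<in> carrier_mat n n" using A by simp
    show ?thesis unfolding det_def'[OF M]
      by (intro sum.cong prod.cong arg_cong2[of _ _ _ _ "(*)"] refl) (use A perm in auto)
  qed
  finally show "coeff (det A) (n * m) = det (map_mat (\<lambda>p. coeff p m) A)" .
qed

section \<open>Exponents modulo n in the Leibniz formula\<close>

text \<open>The residue is an integer because the intended values \<open>j - i\<close> can be
  negative.\<close>

definition exponents_cong :: "nat \<Rightarrow> int \<Rightarrow> 'a::zero poly \<Rightarrow> bool" where
  "exponents_cong n r p \<longleftrightarrow> (\<forall>k. coeff p k \<noteq> 0 \<longrightarrow> [int k = r] (mod int n))"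

lemma exponents_cong_mult:
  fixes p q :: "'a::comm_ring_1 poly"
  assumes "exponents_cong n r p" "exponents_cong n s q"
  shows "exponents_cong n (r + s) (p * q)"
  unfolding exponents_cong_def
proof (intro allI impI)
  fix k assume "coeff (p * q) k \<noteq> 0"
  then obtain i where i: "i \<le> k" "coeff p i * coeff q (k - i) \<noteq> 0"
    unfolding coeff_mult by (metis (no_types, lifting) atMost_iff sum.neutral)
  then have "coeff p i \<noteq> 0" "coeff q (k - i) \<noteq> 0" by auto
  then have "[int i + int (k - i) = r + s] (mod int n)"
    using assms unfolding exponents_cong_def by (intro cong_add) auto
  then show "[int k = r + s] (mod int n)" using i(1) by simp
qed

lemma exponents_cong_prod:
  fixes p :: "'b \<Rightarrow> 'a::comm_ring_1 poly"
  assumes "finite S" "\<And>i. i \<in> S \<Longrightarrow> exponents_cong n (r i) (p i)"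
  shows "exponents_cong n (\<Sum>i\<in>S. r i) (\<Prod>i\<in>S. p i)"
  using assms
proof (induction S rule: finite_induct)
  case empty
  then show ?case by (simp add: exponents_cong_def coeff_1)
next
  case (insert i S)
  then show ?case by (simp add: exponents_cong_mult)
qed

text \<open>Along a permutation \<open>p\<close> the offsets \<open>p i - i\<close> add up to zero,
  so every exponent in a Leibniz term is congruent to 0.\<close>

lemma det_exponents_cong:
  fixes A :: "'a::comm_ring_1 poly mat"
  assumes A: "A \<in> carrier_mat n n"
    and cong: "\<And>i j. i < n \<Longrightarrow> j < n \<Longrightarrow> exponents_cong d (int j - int i) (A $$ (i, j))"
    and "coeff (det A) k \<noteq> 0"
  shows "d dvd k"
proof -
  obtain p where p: "p permutes {0..<n}" "signof p * coeff (\<Prod>i = 0..<n. A $$ (i, p i)) k \<noteq> 0"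
    using assms(3) unfolding det_def'[OF A] coeff_sum coeff_signof_mult
    by (metis (no_types, lifting) mem_Collect_eq sum.neutral)
  have "exponents_cong d (\<Sum>i = 0..<n. int (p i) - int i) (\<Prod>i = 0..<n. A $$ (i, p i))"
    using permutes_in_image[OF p(1)] by (intro exponents_cong_prod cong) auto
  moreover have "(\<Sum>i = 0..<n. int (p i) - int i) = 0"
    using sum.permute[OF p(1), of int] by (simp add: sum_subtractf comp_def)
  ultimately have "[int k = 0] (mod int d)" using p(2) unfolding exponents_cong_def by (metis mult_zero_right)
  then show ?thesis by (simp add: cong_0_iff)
qed

section \<open>Cyclic shifts and diagonal matrices\<close>

definition shift_mat :: "nat \<Rightarrow> nat \<Rightarrow> 'a::comm_ring_1 mat" where
  "shift_mat n m = mat n n (\<lambda>(i, j). if (i + m) mod n = j then 1 else 0)"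

text \<open>For a shift by one, only row \<open>n - 1\<close> wraps round to column 0. Expansion
  along that column leaves an identity minor with sign \<open>(-1) ^ (n - 1)\<close>. Further shifts
  are powers of this one.\<close>

lemma det_shift_mat:
  assumes "0 < n"
  shows "det (shift_mat n m :: 'a::comm_ring_1 mat) = (-1) ^ (m * (n - 1))"
proof -
  have car: "(shift_mat n m :: 'a mat) \<in> carrier_mat n n" for m by (simp add: shift_mat_def)
  have d1: "det (shift_mat n 1 :: 'a mat) = (-1) ^ (n - 1)"
  proof -
    let ?P = "shift_mat n 1 :: 'a mat"
    have "det ?P = (\<Sum>i<n. ?P $$ (i, 0) * cofactor ?P i 0)"
      by (rule laplace_expansion_column[OF car assms])
    also have "\<dots> = (\<Sum>i<n. if i = n - 1 then cofactor ?P i 0 else 0)"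
    proof (rule sum.cong)
      fix i assume "i \<in> {..<n}"
      then show "?P $$ (i, 0) * cofactor ?P i 0 = (if i = n - 1 then cofactor ?P i 0 else 0)"
        using assms by (cases "Suc i = n") (auto simp: shift_mat_def)
    qed simp
    also have "\<dots> = cofactor ?P (n - 1) 0" using assms by simp
    also have "mat_delete ?P (n - 1) 0 = 1\<^sub>m (n - 1)"
      by (rule eq_matI) (auto simp: mat_delete_def shift_mat_def)
    then have "cofactor ?P (n - 1) 0 = (-1) ^ (n - 1)" by (simp add: cofactor_def)
    finally show ?thesis .
  qed
  show ?thesis
  proof (induction m)
    case 0
    have "shift_mat n 0 = (1\<^sub>m n :: 'a mat)" by (rule eq_matI) (auto simp: shift_mat_def)
    then show ?case by simp
  next
    case (Suc m)
    have "shift_mat n (Suc m) = (shift_mat n m * shift_mat n 1 :: 'a mat)"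
    proof (rule eq_matI)
      fix i j assume "i < dim_row (shift_mat n m * shift_mat n 1 :: 'a mat)"
        "j < dim_col (shift_mat n m * shift_mat n 1 :: 'a mat)"
      then have ij: "i < n" "j < n" by (simp_all add: shift_mat_def)
      have "(shift_mat n m * shift_mat n 1 :: 'a mat) $$ (i, j)
          = (\<Sum>r = 0..<n. shift_mat n m $$ (i, r) * shift_mat n 1 $$ (r, j))"
        using ij by (simp add: shift_mat_def scalar_prod_def)
      also have "\<dots> = (\<Sum>r = 0..<n. if r = (i + m) mod n then (if (r + 1) mod n = j then 1 else 0) else 0)"
        using ij by (intro sum.cong) (auto simp: shift_mat_def)
      also have "\<dots> = (if ((i + m) mod n + 1) mod n = j then 1 else 0)"
        using assms by simp
      also have "((i + m) mod n + 1) mod n = (i + Suc m) mod n" by (simp add: mod_Suc_eq)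
      finally show "shift_mat n (Suc m) $$ (i, j) = (shift_mat n m * shift_mat n 1 :: 'a mat) $$ (i, j)"
        using ij by (simp add: shift_mat_def)
    qed (simp_all add: shift_mat_def)
    then show ?case using det_mult[OF car car, of m 1] Suc d1 by (simp add: power_add mult.commute)
  qed
qed

lemma det_diagonal:
  fixes a :: "nat \<Rightarrow> 'a::comm_ring_1"
  shows "det (mat n n (\<lambda>(i, j). if i = j then a i else 0)) = (\<Prod>i<n. a i)"
proof -
  let ?D = "mat n n (\<lambda>(i, j). if i = j then a i else 0)"
  have "det ?D = prod_list (diag_mat ?D)"
    by (rule det_upper_triangular[of _ n]) (auto simp: upper_triangular_def)
  also have "diag_mat ?D = map a [0..<n]" by (auto simp: diag_mat_def)
  also have "prod_list (map a [0..<n]) = (\<Prod>i<n. a i)"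
    by (simp add: prod.distinct_set_conv_list[symmetric] lessThan_atLeast0)
  finally show ?thesis .
qed

lemma det_scaled_shift_mat:
  fixes a :: "nat \<Rightarrow> 'a::comm_ring_1"
  assumes "0 < n"
  shows "det (mat n n (\<lambda>(i, j). if (i + m) mod n = j then a i else 0)) = (-1) ^ (m * (n - 1)) * (\<Prod>i<n. a i)"
proof -
  let ?D = "mat n n (\<lambda>(i, j). if i = j then a i else 0)"
  have "mat n n (\<lambda>(i, j). if (i + m) mod n = j then a i else 0) = ?D * shift_mat n m"
  proof (rule eq_matI)
    fix i j assume "i < dim_row (?D * shift_mat n m)" "j < dim_col (?D * shift_mat n m)"
    then have ij: "i < n" "j < n" by (simp_all add: shift_mat_def)
    have "(?D * shift_mat n m) $$ (i, j) = (\<Sum>r = 0..<n. ?D $$ (i, r) * shift_mat n m $$ (r, j))"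
      using ij by (simp add: shift_mat_def scalar_prod_def)
    also have "\<dots> = (\<Sum>r = 0..<n. if r = i then a i * (if (i + m) mod n = j then 1 else 0) else 0)"
      using ij by (intro sum.cong) (auto simp: shift_mat_def)
    finally show "mat n n (\<lambda>(i, j). if (i + m) mod n = j then a i else 0) $$ (i, j) = (?D * shift_mat n m) $$ (i, j)"
      using ij by simp
  qed (simp_all add: shift_mat_def)
  moreover have "det (?D * shift_mat n m) = det ?D * det (shift_mat n m :: 'a mat)"
    by (rule det_mult[of _ n]) (simp_all add: shift_mat_def)
  ultimately show ?thesis by (simp add: det_diagonal det_shift_mat[OF assms] mult.commute)
qed

section \<open>The action on \<open>K\<close>\<close>

text \<open>Coefficients beyond the degree are zero and \<open>\<sigma> ^^ i\<close> preserves zero,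
  so the degree bounds of \<open>skew_mult\<close> give way to a twisted convolution.\<close>

lemma coeff_skew_mult:
  fixes \<sigma> :: "'k::field \<Rightarrow> 'k"
  assumes "field_hom \<sigma>"
  shows "coeff (skew_mult \<sigma> f g) k = (\<Sum>i\<le>k. coeff f i * (\<sigma> ^^ i) (coeff g (k - i)))"
proof -
  interpret sp: field_hom "\<sigma> ^^ l" for l by (rule funpow_field_hom[OF assms])
  have inner: "(\<Sum>j\<le>degree g. if i + j = k then coeff f i * (\<sigma> ^^ i) (coeff g j) else 0)
      = (if i \<le> k then coeff f i * (\<sigma> ^^ i) (coeff g (k - i)) else 0)" for i
  proof (cases "i \<le> k")
    case True
    have "(\<Sum>j\<le>degree g. if i + j = k then coeff f i * (\<sigma> ^^ i) (coeff g j) else 0)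
        = (\<Sum>j\<le>degree g. if j = k - i then coeff f i * (\<sigma> ^^ i) (coeff g (k - i)) else 0)"
      using True by (intro sum.cong) auto
    then show ?thesis using True by (auto simp: coeff_eq_0)
  next
    case False
    then show ?thesis by (intro trans[OF sum.neutral]) auto
  qed
  have "coeff (skew_mult \<sigma> f g) k
      = (\<Sum>i\<le>degree f. if i \<le> k then coeff f i * (\<sigma> ^^ i) (coeff g (k - i)) else 0)"
    unfolding skew_mult_def by (simp add: coeff_sum coeff_monom inner)
  also have "\<dots> = (\<Sum>i\<in>{..degree f} \<inter> {..k}. coeff f i * (\<sigma> ^^ i) (coeff g (k - i)))"
    by (subst sum.inter_restrict) auto
  also have "\<dots> = (\<Sum>i\<le>k. coeff f i * (\<sigma> ^^ i) (coeff g (k - i)))"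
    by (rule sum.mono_neutral_left) (auto simp: coeff_eq_0 not_le)
  finally show ?thesis .
qed

context cyclic_data
begin

sublocale \<iota>: field_hom \<iota> by (rule hom_\<iota>)
sublocale \<sigma>: field_hom \<sigma> by (rule hom_\<sigma>)
sublocale \<sigma>k: field_hom "\<sigma> ^^ k" for k by (rule funpow_field_hom[OF hom_\<sigma>])

lemma \<sigma>k_\<iota> [simp]: "(\<sigma> ^^ k) (\<iota> c) = \<iota> c"
  by (induction k) (auto simp: \<sigma>_\<iota>)

lemma crd_0 [simp]: "crd j 0 = 0"
  using crd_scale[of j 0 0] by simp

lemma crd_sum: "crd j (sum g A) = (\<Sum>a\<in>A. crd j (g a))"
  by (induction A rule: infinite_finite_induct) (auto simp: crd_add)

text \<open>The operator sending \<open>v\<close> to \<open>a * (\<sigma> ^^ k) v\<close> is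
  F-linear, so its value at \<open>v\<close> is its matrix in the basis \<open>b\<close> applied to
  the coordinates of \<open>v\<close>.\<close>

lemma crd_mult_expand:
  "crd p (a * (\<sigma> ^^ k) v) = (\<Sum>r<n. crd p (a * (\<sigma> ^^ k) (b r)) * crd r v)"
proof -
  have "a * (\<sigma> ^^ k) v = (\<Sum>r<n. \<iota> (crd r v) * (a * (\<sigma> ^^ k) (b r)))"
    by (subst (1) expand[of v, symmetric])
      (simp add: \<sigma>k.hom_sum \<sigma>k.hom_mult sum_distrib_left mult.left_commute)
  then show ?thesis by (simp add: crd_sum crd_scale mult.commute)
qed

lemma \<sigma>_mod: "(\<sigma> ^^ (k mod n)) a = (\<sigma> ^^ k) a"
proof -
  have "(\<sigma> ^^ (n * j)) a = a" for j a
    by (induction j) (auto simp: funpow_add \<sigma>_n)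
  then show ?thesis
    by (metis comp_apply funpow_add mod_mult_div_eq)
qed

text \<open>Here \<open>t\<close> acts as \<open>T \<sigma>\<close>, where the indeterminate \<open>T\<close> of the matrix entries is central.\<close>

definition reg :: "'k poly \<Rightarrow> 'f poly mat" where
  "reg f = mat n n (\<lambda>(p, q). \<Sum>k\<le>degree f. monom (crd p (coeff f k * (\<sigma> ^^ k) (b q))) k)"

lemma reg_carrier [simp]: "reg f \<in> carrier_mat n n" "dim_row (reg f) = n" "dim_col (reg f) = n"
  by (simp_all add: reg_def)

lemma coeff_reg:
  assumes "p < n" "q < n"
  shows "coeff (reg f $$ (p, q)) k = crd p (coeff f k * (\<sigma> ^^ k) (b q))"
proof -
  have "coeff (reg f $$ (p, q)) k = (\<Sum>i\<le>degree f. if i = k then crd p (coeff f k * (\<sigma> ^^ k) (b q)) else 0)"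
    using assms by (auto simp: reg_def coeff_sum coeff_monom intro!: sum.cong)
  then show ?thesis by (auto simp: coeff_eq_0)
qed

lemma reg_add: "reg (f + g) = reg f + reg g"
  by (rule eq_matI) (auto intro!: poly_eqI simp: coeff_reg distrib_right crd_add)

text \<open>At \<open>T^k\<close> the matrix product composes the operators
  \<open>a \<sigma>^i\<close> and \<open>c \<sigma>^(k-i)\<close>. Their composite is
  \<open>a \<sigma>^i(c) \<sigma>^k\<close>, which is the multiplication rule of the skew polynomial
  ring.\<close>

lemma reg_mult: "reg (skew_mult \<sigma> f g) = reg f * reg g"
proof (rule eq_matI)
  fix p q assume "p < dim_row (reg f * reg g)" "q < dim_col (reg f * reg g)"
  then have pq: "p < n" "q < n" by simp_all
  show "reg (skew_mult \<sigma> f g) $$ (p, q) = (reg f * reg g) $$ (p, q)"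
  proof (rule poly_eqI)
    fix k
    have "coeff ((reg f * reg g) $$ (p, q)) k = (\<Sum>r<n. coeff (reg f $$ (p, r) * reg g $$ (r, q)) k)"
      using pq by (simp add: scalar_prod_def coeff_sum lessThan_atLeast0)
    also have "\<dots> = (\<Sum>r<n. \<Sum>i\<le>k. crd p (coeff f i * (\<sigma> ^^ i) (b r)) * crd r (coeff g (k - i) * (\<sigma> ^^ (k - i)) (b q)))"
      using pq by (simp add: coeff_mult coeff_reg)
    also have "\<dots> = (\<Sum>i\<le>k. crd p (coeff f i * (\<sigma> ^^ i) (coeff g (k - i) * (\<sigma> ^^ (k - i)) (b q))))"
      by (subst sum.swap) (simp add: crd_mult_expand[of p _ _ "_ * _"])
    also have "\<dots> = (\<Sum>i\<le>k. crd p (coeff f i * (\<sigma> ^^ i) (coeff g (k - i)) * (\<sigma> ^^ k) (b q)))"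
    proof (rule sum.cong)
      fix i assume "i \<in> {..k}"
      then have "(\<sigma> ^^ i) ((\<sigma> ^^ (k - i)) a) = (\<sigma> ^^ k) a" for a
        by (metis atMost_iff comp_apply funpow_add le_add_diff_inverse)
      then show "crd p (coeff f i * (\<sigma> ^^ i) (coeff g (k - i) * (\<sigma> ^^ (k - i)) (b q)))
          = crd p (coeff f i * (\<sigma> ^^ i) (coeff g (k - i)) * (\<sigma> ^^ k) (b q))"
        by (simp add: \<sigma>k.hom_mult mult.assoc)
    qed simp
    also have "\<dots> = coeff (reg (skew_mult \<sigma> f g) $$ (p, q)) k"
      using pq by (simp add: coeff_reg coeff_skew_mult[OF hom_\<sigma>] crd_sum sum_distrib_right)
    finally show "coeff (reg (skew_mult \<sigma> f g) $$ (p, q)) k = coeff ((reg f * reg g) $$ (p, q)) k" ..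
  qed
qed simp_all

lemma coeff_center_emb:
  "coeff (center_emb \<iota> n p) k = (if n dvd k then \<iota> (coeff p (k div n)) else 0)"
proof -
  have "coeff (center_emb \<iota> n p) k = (\<Sum>i\<le>degree p. if n * i = k then \<iota> (coeff p i) else 0)"
    by (simp add: center_emb_def coeff_sum coeff_monom)
  also have "\<dots> = (if n dvd k then \<iota> (coeff p (k div n)) else 0)"
  proof (cases "n dvd k")
    case True
    then have "(\<Sum>i\<le>degree p. if n * i = k then \<iota> (coeff p i) else 0)
        = (\<Sum>i\<le>degree p. if i = k div n then \<iota> (coeff p (k div n)) else 0)"
      using n_pos by (intro sum.cong) auto
    then show ?thesis using True by (auto simp: coeff_eq_0)
  next
    case False
    then show ?thesis by (intro trans[OF sum.neutral]) auto
  qed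
  finally show ?thesis .
qed

text \<open>Multiples of \<open>n\<close> as exponents turn \<open>\<sigma>\<close> into the
  identity, so \<open>x = t^n\<close> acts as the scalar \<open>T^n\<close>.\<close>

lemma reg_center: "reg (center_emb \<iota> n p) = pcompose p (monom 1 n) \<cdot>\<^sub>m 1\<^sub>m n"
proof (rule eq_matI)
  fix i j assume "i < dim_row (pcompose p (monom 1 n) \<cdot>\<^sub>m 1\<^sub>m n)" "j < dim_col (pcompose p (monom 1 n) \<cdot>\<^sub>m 1\<^sub>m n)"
  then have ij: "i < n" "j < n" by simp_all
  have "(\<sigma> ^^ k) a = a" if "n dvd k" for k a
    using \<sigma>_mod[of k a] that by simp
  with ij show "reg (center_emb \<iota> n p) $$ (i, j) = (pcompose p (monom 1 n) \<cdot>\<^sub>m 1\<^sub>m n) $$ (i, j)"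
    by (intro poly_eqI)
      (auto simp: coeff_reg coeff_center_emb coeff_pcompose_monom_one[OF n_pos] crd_scale crd_basis)
qed simp_all

text \<open>Over \<open>K\<close>, the Dedekind matrix \<open>V = (\<sigma>\<^sup>i(b\<^sub>j))\<close> conjugates \<open>reg f\<close> into the following matrix,
  whose \<open>(i, j)\<close> entry has only exponents congruent to \<open>j - i\<close> modulo \<open>n\<close>.\<close>

definition cyc :: "'k poly \<Rightarrow> 'k poly mat" where
  "cyc f = mat n n (\<lambda>(i, j). \<Sum>k\<le>degree f. if (i + k) mod n = j then monom ((\<sigma> ^^ i) (coeff f k)) k else 0)"

lemma cyc_carrier [simp]: "cyc f \<in> carrier_mat n n" "dim_row (cyc f) = n" "dim_col (cyc f) = n"
  by (simp_all add: cyc_def)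

lemma coeff_cyc:
  assumes "i < n" "j < n"
  shows "coeff (cyc f $$ (i, j)) k = (if (i + k) mod n = j then (\<sigma> ^^ i) (coeff f k) else 0)"
proof -
  have "coeff (cyc f $$ (i, j)) k
      = (\<Sum>l\<le>degree f. coeff (if (i + l) mod n = j then monom ((\<sigma> ^^ i) (coeff f l)) l else 0) k)"
    using assms by (simp add: cyc_def coeff_sum)
  also have "\<dots> = (\<Sum>l\<le>degree f. if l = k then (if (i + k) mod n = j then (\<sigma> ^^ i) (coeff f k) else 0) else 0)"
    by (rule sum.cong) (auto simp: coeff_monom)
  finally show ?thesis by (auto simp: coeff_eq_0)
qed

lemma map_det_reg: "map_poly \<iota> (det (reg f)) = det (cyc f)"
proof -
  interpret mp: map_poly_comm_ring_hom \<iota> ..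
  define V where "V = mat n n (\<lambda>(i, j). [:(\<sigma> ^^ i) (b j):])"
  define W' where "W' = mat n n (\<lambda>(i, j). [:W i j:])"
  let ?R = "map_mat (map_poly \<iota>) (reg f)"
  have V: "V \<in> carrier_mat n n" and W': "W' \<in> carrier_mat n n" by (simp_all add: V_def W'_def)
  have const_sum: "(\<Sum>q\<in>A. [:h q:]) = [:\<Sum>q\<in>A. h q:]" for h :: "nat \<Rightarrow> 'k" and A
    by (induction A rule: infinite_finite_induct) auto
  have VW': "(\<Sum>q<n. W q k * (\<sigma> ^^ i) (b q)) = (if i = k then 1 else 0)" if "i < n" "k < n" for i k
    using VW[OF that] by (simp add: mult.commute)
  have "V * W' = 1\<^sub>m n"
    by (rule eq_matI)
      (auto simp: V_def W'_def scalar_prod_def const_sum VW' lessThan_atLeast0[symmetric] simp flip: one_pCons)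
  then have "det V * det W' = 1" using det_mult[OF V W'] by simp
  then have detV: "det V \<noteq> 0" by auto
  \<comment> \<open>Row \<open>i\<close> of \<open>V\<close> reassembles an element of K from its
    coordinates and applies \<open>\<sigma> ^^ i\<close>. Since \<open>\<sigma>^i(a_k
    \<sigma>^k(b_q)) = \<sigma>^i(a_k) \<sigma>^(i+k)(b_q)\<close>, the result is a multiple of an
    entry in row \<open>(i + k) mod n\<close> of \<open>V\<close>.\<close>
  have "V * ?R = cyc f * V"
  proof (rule eq_matI)
    fix i q assume "i < dim_row (cyc f * V)" "q < dim_col (cyc f * V)"
    then have iq: "i < n" "q < n" by (simp_all add: V_def)
    show "(V * ?R) $$ (i, q) = (cyc f * V) $$ (i, q)"
    proof (rule poly_eqI)
      fix k
      have "coeff ((V * ?R) $$ (i, q)) k = (\<Sum>p<n. (\<sigma> ^^ i) (b p) * \<iota> (crd p (coeff f k * (\<sigma> ^^ k) (b q))))"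
        using iq by (simp add: V_def scalar_prod_def coeff_sum lessThan_atLeast0 coeff_reg coeff_map_poly)
      also have "\<dots> = (\<sigma> ^^ i) (\<Sum>p<n. \<iota> (crd p (coeff f k * (\<sigma> ^^ k) (b q))) * b p)"
        by (simp add: \<sigma>k.hom_sum \<sigma>k.hom_mult mult.commute)
      also have "\<dots> = (\<sigma> ^^ i) (coeff f k) * (\<sigma> ^^ ((i + k) mod n)) (b q)"
        unfolding expand by (simp add: \<sigma>k.hom_mult \<sigma>_mod funpow_add)
      also have "\<dots> = (\<Sum>j<n. if j = (i + k) mod n then (\<sigma> ^^ i) (coeff f k) * (\<sigma> ^^ ((i + k) mod n)) (b q) else 0)"
        using n_pos by simp
      also have "\<dots> = (\<Sum>j<n. coeff (cyc f $$ (i, j)) k * (\<sigma> ^^ j) (b q))"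
        using iq by (intro sum.cong) (auto simp: coeff_cyc)
      also have "\<dots> = coeff ((cyc f * V) $$ (i, q)) k"
        using iq by (simp add: V_def scalar_prod_def coeff_sum lessThan_atLeast0 mult.commute)
      finally show "coeff ((V * ?R) $$ (i, q)) k = coeff ((cyc f * V) $$ (i, q)) k" .
    qed
  qed (simp_all add: V_def)
  then have "det V * det ?R = det (cyc f) * det V"
    using det_mult[of V n ?R] det_mult[of "cyc f" n V] V by (auto simp del: mp.hom_det)
  then have "det ?R = det (cyc f)" using detV by simp
  then show ?thesis by (simp add: mp.hom_det)
qed

lemma field_norm_eq_0_iff: "field_norm \<iota> a = 0 \<longleftrightarrow> a = 0"
proof -
  have "field_norm \<iota> a = 0 \<longleftrightarrow> (\<Prod>i<n. (\<sigma> ^^ i) a) = 0"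
    unfolding norm[symmetric] by simp
  then show ?thesis using n_pos by auto
qed

text \<open>All claims are checked on \<open>det (cyc f)\<close> over K and pulled back along the
  injective \<open>\<iota>\<close>.\<close>

lemma det_reg:
  assumes "f \<noteq> 0"
  obtains Q where "det (reg f) = pcompose Q (monom 1 n)" "degree Q = degree f"
    "coeff Q 0 = field_norm \<iota> (coeff f 0)"
    "coeff Q (degree f) = (-1) ^ (degree f * (n - 1)) * field_norm \<iota> (coeff f (degree f))"
proof -
  define d where "d = det (reg f)"
  define m where "m = degree f"
  have \<iota>d: "\<iota> (coeff d k) = coeff (det (cyc f)) k" for k
    unfolding d_def map_det_reg[symmetric] by (simp add: coeff_map_poly)
  have degC: "degree (cyc f $$ (i, j)) \<le> m" if "i < n" "j < n" for i j
    using that by (intro degree_le) (auto simp: coeff_cyc coeff_eq_0 m_def)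
  have top: "coeff d (n * m) = (-1) ^ (m * (n - 1)) * field_norm \<iota> (coeff f m)"
  proof -
    \<comment> \<open>The coefficients at \<open>T^m\<close> form a diagonal of conjugates of the
      leading coefficient times the \<open>m\<close>-th cyclic shift.\<close>
    have "map_mat (\<lambda>p. coeff p m) (cyc f) = mat n n (\<lambda>(i, j). if (i + m) mod n = j then (\<sigma> ^^ i) (coeff f m) else 0)"
      by (rule eq_matI) (auto simp: coeff_cyc)
    then have "\<iota> (coeff d (n * m)) = \<iota> ((-1) ^ (m * (n - 1)) * field_norm \<iota> (coeff f m))"
      unfolding \<iota>d using det_degree_bound(2)[of "cyc f" n m] degC
      by (simp add: det_scaled_shift_mat[OF n_pos] \<iota>.hom_mult norm hom_distribs)
    then show ?thesis by simp
  qed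
  have bot: "coeff d 0 = field_norm \<iota> (coeff f 0)"
  proof -
    \<comment> \<open>Taking the constant term is a ring homomorphism and so commutes with the
      determinant.\<close>
    interpret c0: comm_ring_hom "\<lambda>p. coeff p 0 :: 'k"
      by unfold_locales (auto simp: coeff_mult)
    have "map_mat (\<lambda>p. coeff p 0) (cyc f) = mat n n (\<lambda>(i, j). if i = j then (\<sigma> ^^ i) (coeff f 0) else 0)"
      by (rule eq_matI) (auto simp: coeff_cyc)
    then have "\<iota> (coeff d 0) = \<iota> (field_norm \<iota> (coeff f 0))"
      unfolding \<iota>d c0.hom_det[symmetric] by (simp add: det_diagonal norm)
    then show ?thesis by simp
  qed
  have deg: "coeff d k = 0" if "n * m < k" for k
  proof -
    have "degree (det (cyc f)) \<le> n * m" by (rule det_degree_bound(1)) (auto simp: degC)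
    then have "\<iota> (coeff d k) = 0" unfolding \<iota>d using that by (intro coeff_eq_0) simp
    then show ?thesis by simp
  qed
  have supp: "coeff d k = 0" if "\<not> n dvd k" for k
  proof -
    have "exponents_cong n (int j - int i) (cyc f $$ (i, j))" if "i < n" "j < n" for i j
      unfolding exponents_cong_def
    proof (intro allI impI)
      fix k assume "coeff (cyc f $$ (i, j)) k \<noteq> 0"
      then have "(i + k) mod n = j" using that by (auto simp: coeff_cyc split: if_splits)
      then have "[i + k = j] (mod n)" using that(2) by (simp add: cong_def)
      then have "[int i + int k = int j] (mod int n)" by (metis cong_int_iff of_nat_add)
      then show "[int k = int j - int i] (mod int n)" by (simp add: cong_iff_dvd_diff algebra_simps)
    qed
    then have "coeff (det (cyc f)) k = 0" using det_exponents_cong[of "cyc f" n n k] that by auto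
    then have "\<iota> (coeff d k) = 0" unfolding \<iota>d .
    then show ?thesis by simp
  qed
  \<comment> \<open>\<open>Q\<close> collects the coefficients of \<open>d\<close> at multiples of
    \<open>n\<close>; by \<open>deg\<close> there are none beyond \<open>n * m\<close>.\<close>
  define Q where "Q = (\<Sum>k\<le>m. monom (coeff d (n * k)) k)"
  have Q: "coeff Q k = coeff d (n * k)" for k
    using n_pos deg[of "n * k"] by (auto simp: Q_def coeff_sum coeff_monom)
  show ?thesis
  proof (rule that[of Q])
    show "det (reg f) = pcompose Q (monom 1 n)"
      unfolding d_def[symmetric]
      by (rule poly_eqI) (auto simp: coeff_pcompose_monom_one[OF n_pos] Q supp)
    show "coeff Q 0 = field_norm \<iota> (coeff f 0)" by (simp add: Q bot)
    show lead: "coeff Q (degree f) = (-1) ^ (degree f * (n - 1)) * field_norm \<iota> (coeff f (degree f))"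
      using top by (simp add: Q m_def)
    \<comment> \<open>The norm of the nonzero leading coefficient is nonzero, so the degree is
      exactly \<open>m\<close>.\<close>
    have "coeff Q m \<noteq> 0" using lead assms by (simp add: m_def field_norm_eq_0_iff)
    then have "m \<le> degree Q" by (rule le_degree)
    moreover have "degree Q \<le> m" using n_pos deg by (intro degree_le) (auto simp: Q)
    ultimately show "degree Q = degree f" by (simp add: m_def)
  qed
qed

end

section \<open>The Skolem-Noether theorem for matrix algebras\<close>

text \<open>The entrywise form fixes the size also for empty \<open>B\<close> and reduces every
  identity to sums in the field.\<close>

definition lincomb :: "nat \<Rightarrow> 'b set \<Rightarrow> ('b \<Rightarrow> 'l::field) \<Rightarrow> ('b \<Rightarrow> 'l mat) \<Rightarrow> 'l mat" where
  "lincomb n B c Z = mat n n (\<lambda>pq. \<Sum>b\<in>B. c b * Z b $$ pq)"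

lemma lincomb_carrier [simp]:
  "lincomb n B c Z \<in> carrier_mat n n" "dim_row (lincomb n B c Z) = n" "dim_col (lincomb n B c Z) = n"
  by (simp_all add: lincomb_def)

lemma index_lincomb [simp]:
  "p < n \<Longrightarrow> q < n \<Longrightarrow> lincomb n B c Z $$ (p, q) = (\<Sum>b\<in>B. c b * Z b $$ (p, q))"
  by (simp add: lincomb_def)

lemma lincomb_cong:
  assumes "\<And>b. b \<in> B \<Longrightarrow> c b = c' b" "\<And>b. b \<in> B \<Longrightarrow> Z b = Z' b"
  shows "lincomb n B c Z = lincomb n B c' Z'"
  unfolding lincomb_def using assms by (intro arg_cong[of _ _ "mat n n"] ext sum.cong) auto

lemma lincomb_lincomb:
  "lincomb n S d (\<lambda>i. lincomb n B (c i) Z) = lincomb n B (\<lambda>b. \<Sum>i\<in>S. d i * c i b) Z"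
proof (rule eq_matI)
  fix p q assume "p < dim_row (lincomb n B (\<lambda>b. \<Sum>i\<in>S. d i * c i b) Z)"
    "q < dim_col (lincomb n B (\<lambda>b. \<Sum>i\<in>S. d i * c i b) Z)"
  then have "p < n" "q < n" by simp_all
  then show "lincomb n S d (\<lambda>i. lincomb n B (c i) Z) $$ (p, q)
      = lincomb n B (\<lambda>b. \<Sum>i\<in>S. d i * c i b) Z $$ (p, q)"
    by (simp add: sum_distrib_left sum_distrib_right mult.assoc) (rule sum.swap)
qed simp_all

lemma lincomb_mult:
  assumes "\<And>b. b \<in> B \<Longrightarrow> Z b \<in> carrier_mat n n" "\<And>b. b \<in> B' \<Longrightarrow> Y b \<in> carrier_mat n n"
  shows "lincomb n B c Z * lincomb n B' c' Y
    = lincomb n (B \<times> B') (\<lambda>(b, b'). c b * c' b') (\<lambda>(b, b'). Z b * Y b')"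
proof (rule eq_matI)
  fix p q assume "p < dim_row (lincomb n (B \<times> B') (\<lambda>(b, b'). c b * c' b') (\<lambda>(b, b'). Z b * Y b'))"
    "q < dim_col (lincomb n (B \<times> B') (\<lambda>(b, b'). c b * c' b') (\<lambda>(b, b'). Z b * Y b'))"
  then have pq: "p < n" "q < n" by simp_all
  have "(lincomb n B c Z * lincomb n B' c' Y) $$ (p, q)
      = (\<Sum>r = 0..<n. (\<Sum>b\<in>B. c b * Z b $$ (p, r)) * (\<Sum>b'\<in>B'. c' b' * Y b' $$ (r, q)))"
    using pq by (simp add: scalar_prod_def)
  also have "\<dots> = (\<Sum>r = 0..<n. \<Sum>(b, b')\<in>B \<times> B'. c b * Z b $$ (p, r) * (c' b' * Y b' $$ (r, q)))"
    by (simp add: sum_product sum.cartesian_product)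
  also have "\<dots> = (\<Sum>(b, b')\<in>B \<times> B'. \<Sum>r = 0..<n. c b * Z b $$ (p, r) * (c' b' * Y b' $$ (r, q)))"
    by (subst sum.swap) (simp add: case_prod_unfold)
  also have "\<dots> = (\<Sum>(b, b')\<in>B \<times> B'. c b * c' b' * (Z b * Y b') $$ (p, q))"
  proof (rule sum.cong)
    fix bb assume bb: "bb \<in> B \<times> B'"
    obtain b b' where [simp]: "bb = (b, b')" by (cases bb)
    have "Z b \<in> carrier_mat n n" "Y b' \<in> carrier_mat n n" using bb assms by auto
    then show "(case bb of (b, b') \<Rightarrow> \<Sum>r = 0..<n. c b * Z b $$ (p, r) * (c' b' * Y b' $$ (r, q)))
        = (case bb of (b, b') \<Rightarrow> c b * c' b' * (Z b * Y b') $$ (p, q))"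
      using pq by (auto simp: scalar_prod_def sum_distrib_left intro!: sum.cong)
  qed simp
  finally show "(lincomb n B c Z * lincomb n B' c' Y) $$ (p, q)
      = lincomb n (B \<times> B') (\<lambda>(b, b'). c b * c' b') (\<lambda>(b, b'). Z b * Y b') $$ (p, q)"
    using pq by (simp add: case_prod_unfold)
qed simp_all

text \<open>The algebra endomorphism \<open>\<alpha>\<close> of the
  matrices that takes \<open>\<phi> b\<close> to \<open>\<psi> b\<close> is the conjugation by the matrix whose \<open>k\<close>-th column
  is a fixed, suitable column of \<open>\<alpha> (E\<^sub>k\<^sub>0)\<close>.\<close>

lemma det_lincomb_eq:
  fixes \<phi> \<psi> :: "'b \<Rightarrow> 'l::field mat"
  assumes n: "0 < n"
    and carrier: "\<And>b. b \<in> B \<Longrightarrow> \<phi> b \<in> carrier_mat n n" "\<And>b. b \<in> B \<Longrightarrow> \<psi> b \<in> carrier_mat n n"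
    and mult: "\<And>a b. a \<in> B \<Longrightarrow> b \<in> B \<Longrightarrow>
      \<exists>d. \<phi> a * \<phi> b = lincomb n B d \<phi> \<and> \<psi> a * \<psi> b = lincomb n B d \<psi>"
    and one: "\<exists>d. 1\<^sub>m n = lincomb n B d \<phi> \<and> 1\<^sub>m n = lincomb n B d \<psi>"
    and basis: "\<And>U. U \<in> carrier_mat n n \<Longrightarrow> \<exists>!c. c \<in> B \<rightarrow>\<^sub>E UNIV \<and> U = lincomb n B c \<phi>"
  shows "det (lincomb n B d \<phi>) = det (lincomb n B d \<psi>)"
proof -
  define C where "C U = (THE c. c \<in> B \<rightarrow>\<^sub>E UNIV \<and> U = lincomb n B c \<phi>)" for U
  define \<alpha> where "\<alpha> U = lincomb n B (C U) \<psi>" for U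
  have C: "lincomb n B (C U) \<phi> = U" if "U \<in> carrier_mat n n" for U
    using theI'[OF basis[OF that]] unfolding C_def by simp
  have \<alpha>_carrier [simp]: "\<alpha> U \<in> carrier_mat n n" "dim_row (\<alpha> U) = n" "dim_col (\<alpha> U) = n" for U
    by (simp_all add: \<alpha>_def)
  have \<alpha>_\<phi>: "\<alpha> (lincomb n B d \<phi>) = lincomb n B d \<psi>" for d
  proof -
    \<comment> \<open>Coordinates are unique among functions that are undefined off
      \<open>B\<close>, hence the restriction.\<close>
    have "C (lincomb n B d \<phi>) = restrict d B"
      unfolding C_def
    proof (rule the1_equality[OF basis])
      show "restrict d B \<in> B \<rightarrow>\<^sub>E UNIV \<and> lincomb n B d \<phi> = lincomb n B (restrict d B) \<phi>"
        by (auto intro: lincomb_cong)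
    qed simp
    then show ?thesis unfolding \<alpha>_def by (auto intro: lincomb_cong)
  qed
  have \<alpha>_lincomb: "\<alpha> (lincomb n S d Z) = lincomb n S d (\<lambda>i. \<alpha> (Z i))"
    if "\<And>i. i \<in> S \<Longrightarrow> Z i \<in> carrier_mat n n" for S :: "nat set" and d Z
  proof -
    have "lincomb n S d Z = lincomb n S d (\<lambda>i. lincomb n B (C (Z i)) \<phi>)"
      using that by (intro lincomb_cong) (auto simp: C)
    then have "\<alpha> (lincomb n S d Z) = lincomb n B (\<lambda>b. \<Sum>i\<in>S. d i * C (Z i) b) \<psi>"
      by (simp only: lincomb_lincomb \<alpha>_\<phi>)
    then show ?thesis by (simp add: \<alpha>_def[of "Z _"] lincomb_lincomb)
  qed
  have \<alpha>_mult: "\<alpha> (U * V) = \<alpha> U * \<alpha> V" if UV: "U \<in> carrier_mat n n" "V \<in> carrier_mat n n" for U V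
  proof -
    let ?c = "\<lambda>(a, b). C U a * C V b"
    \<comment> \<open>Both families share the structure constants \<open>D\<close>; this is what
      makes \<open>\<alpha>\<close> multiplicative.\<close>
    have "\<exists>D. \<forall>a\<in>B. \<forall>b\<in>B. \<phi> a * \<phi> b = lincomb n B (D (a, b)) \<phi> \<and> \<psi> a * \<psi> b = lincomb n B (D (a, b)) \<psi>"
      by (rule exI[of _ "\<lambda>(a, b). SOME d. \<phi> a * \<phi> b = lincomb n B d \<phi> \<and> \<psi> a * \<psi> b = lincomb n B d \<psi>"])
        (use someI_ex[OF mult] in auto)
    then obtain D where D: "\<And>a b. a \<in> B \<Longrightarrow> b \<in> B \<Longrightarrow> \<phi> a * \<phi> b = lincomb n B (D (a, b)) \<phi>"
      "\<And>a b. a \<in> B \<Longrightarrow> b \<in> B \<Longrightarrow> \<psi> a * \<psi> b = lincomb n B (D (a, b)) \<psi>" by blast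
    have "U * V = lincomb n B (C U) \<phi> * lincomb n B (C V) \<phi>" using UV by (simp add: C)
    also have "\<dots> = lincomb n (B \<times> B) ?c (\<lambda>(a, b). \<phi> a * \<phi> b)"
      by (rule lincomb_mult) (auto simp: carrier)
    also have "\<dots> = lincomb n (B \<times> B) ?c (\<lambda>ab. lincomb n B (D ab) \<phi>)"
      by (rule lincomb_cong) (auto simp: D)
    finally have "\<alpha> (U * V) = lincomb n (B \<times> B) ?c (\<lambda>ab. lincomb n B (D ab) \<psi>)"
      unfolding lincomb_lincomb by (simp add: \<alpha>_\<phi>)
    also have "\<dots> = lincomb n (B \<times> B) ?c (\<lambda>(a, b). \<psi> a * \<psi> b)"
      by (rule lincomb_cong) (auto simp: D)
    also have "\<dots> = \<alpha> U * \<alpha> V"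
      unfolding \<alpha>_def by (rule lincomb_mult[symmetric]) (auto simp: carrier)
    finally show ?thesis .
  qed
  have \<alpha>_one: "\<alpha> (1\<^sub>m n) = 1\<^sub>m n" using one \<alpha>_\<phi> by metis
  define E :: "nat \<Rightarrow> nat \<Rightarrow> 'l mat" where "E k l = mat n n (\<lambda>(i, j). if i = k \<and> j = l then 1 else 0)" for k l
  have E [simp]: "E k l \<in> carrier_mat n n" "dim_row (E k l) = n" "dim_col (E k l) = n" for k l
    by (simp_all add: E_def)
  have E_mult: "E i j * E j l = E i l" if "j < n" for i j l
  proof (rule eq_matI)
    fix p q assume "p < dim_row (E i l)" "q < dim_col (E i l)"
    then have pq: "p < n" "q < n" by simp_all
    have "(E i j * E j l) $$ (p, q) = (\<Sum>r = 0..<n. E i j $$ (p, r) * E j l $$ (r, q))"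
      using pq by (simp add: scalar_prod_def)
    also have "\<dots> = (\<Sum>r = 0..<n. if r = j then (if p = i \<and> q = l then 1 else 0) else 0)"
      by (rule sum.cong) (use pq in \<open>auto simp: E_def\<close>)
    finally show "(E i j * E j l) $$ (p, q) = E i l $$ (p, q)" using that pq by (simp add: E_def)
  qed simp_all
  \<comment> \<open>Each \<open>E i i\<close> factors through \<open>E 0 0\<close>, so if
    \<open>\<alpha>\<close> killed \<open>E 0 0\<close> it would kill their sum, the
    identity.\<close>
  have "\<alpha> (E 0 0) \<noteq> 0\<^sub>m n n"
  proof
    assume zero: "\<alpha> (E 0 0) = 0\<^sub>m n n"
    have "\<alpha> (E i i) = 0\<^sub>m n n" for i
    proof -
      have "E i i = E i 0 * (E 0 0 * E 0 i)" using n by (simp add: E_mult)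
      then have "\<alpha> (E i i) = \<alpha> (E i 0) * (\<alpha> (E 0 0) * \<alpha> (E 0 i))"
        using \<alpha>_mult by (metis E(1) mult_carrier_mat)
      also have "\<dots> = 0\<^sub>m n n" unfolding zero by (simp add: left_mult_zero_mat[of _ n n] right_mult_zero_mat[of _ n n])
      finally show ?thesis .
    qed
    moreover have "1\<^sub>m n = lincomb n {..<n} (\<lambda>_. 1) (\<lambda>i. E i i)"
    proof (rule eq_matI)
      fix p q assume "p < dim_row (lincomb n {..<n} (\<lambda>_. 1) (\<lambda>i. E i i))" "q < dim_col (lincomb n {..<n} (\<lambda>_. 1) (\<lambda>i. E i i))"
      then have pq: "p < n" "q < n" by simp_all
      then have "(\<Sum>i<n. E i i $$ (p, q)) = (\<Sum>i<n. if i = p then (if p = q then 1 else 0) else 0)"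
        by (intro sum.cong) (auto simp: E_def)
      then show "1\<^sub>m n $$ (p, q) = lincomb n {..<n} (\<lambda>_. 1) (\<lambda>i. E i i) $$ (p, q)" using pq by simp
    qed simp_all
    ultimately have "1\<^sub>m n = lincomb n {..<n} (\<lambda>_. 1) (\<lambda>_. 0\<^sub>m n n :: 'l mat)"
      using \<alpha>_lincomb[of "{..<n}" "\<lambda>i. E i i" "\<lambda>_. 1"] \<alpha>_one by simp
    then have "1\<^sub>m n $$ (0, 0) = (0 :: 'l)" using n by simp
    then show False using n by simp
  qed
  then obtain p q where pq: "p < n" "q < n" "\<alpha> (E 0 0) $$ (p, q) \<noteq> 0"
    by (metis \<alpha>_carrier(2,3) eq_matI index_zero_mat(1) index_zero_mat(2) index_zero_mat(3))
  \<comment> \<open>The column index \<open>q\<close> is such that column 0 of \<open>g\<close> has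
    the nonzero entry \<open>\<alpha> (E 0 0) $$ (p, q)\<close> in row \<open>p\<close>.\<close>
  define g where "g = mat n n (\<lambda>(i, k). \<alpha> (E k 0) $$ (i, q))"
  have g: "g \<in> carrier_mat n n" by (simp add: g_def)
  have inter: "\<alpha> U * g = g * U" if U: "U \<in> carrier_mat n n" for U
  proof (rule eq_matI)
    fix i k assume "i < dim_row (g * U)" "k < dim_col (g * U)"
    then have ik: "i < n" "k < n" using U g by simp_all
    \<comment> \<open>Left multiplication by \<open>U\<close> acts on the matrices
      \<open>E k 0\<close> as \<open>U\<close> acts on unit vectors. Applying
      \<open>\<alpha>\<close> and reading column \<open>q\<close> gives the intertwining
      relation.\<close>
    have "U * E k 0 = lincomb n {..<n} (\<lambda>r. U $$ (r, k)) (\<lambda>r. E r 0)"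
    proof (rule eq_matI)
      fix r s assume "r < dim_row (lincomb n {..<n} (\<lambda>r. U $$ (r, k)) (\<lambda>r. E r 0))"
        "s < dim_col (lincomb n {..<n} (\<lambda>r. U $$ (r, k)) (\<lambda>r. E r 0))"
      then have rs: "r < n" "s < n" by simp_all
      have "(U * E k 0) $$ (r, s) = (\<Sum>l = 0..<n. U $$ (r, l) * E k 0 $$ (l, s))"
        using rs U by (simp add: scalar_prod_def)
      also have "\<dots> = (\<Sum>l = 0..<n. if l = k then (if s = 0 then U $$ (r, k) else 0) else 0)"
        by (rule sum.cong) (use rs in \<open>auto simp: E_def\<close>)
      also have "\<dots> = (\<Sum>l<n. if l = r then (if s = 0 then U $$ (r, k) else 0) else 0)"
        using ik rs by simp
      also have "\<dots> = (\<Sum>l<n. U $$ (l, k) * E l 0 $$ (r, s))"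
        by (rule sum.cong) (use rs in \<open>auto simp: E_def\<close>)
      finally show "(U * E k 0) $$ (r, s) = lincomb n {..<n} (\<lambda>r. U $$ (r, k)) (\<lambda>r. E r 0) $$ (r, s)"
        using rs by simp
    qed (use U in simp_all)
    then have "\<alpha> U * \<alpha> (E k 0) = lincomb n {..<n} (\<lambda>r. U $$ (r, k)) (\<lambda>r. \<alpha> (E r 0))"
      using \<alpha>_mult[OF U, of "E k 0"] by (simp add: \<alpha>_lincomb)
    then have "(\<alpha> U * \<alpha> (E k 0)) $$ (i, q) = (\<Sum>r<n. U $$ (r, k) * \<alpha> (E r 0) $$ (i, q))"
      using ik pq by simp
    moreover have "(\<alpha> U * \<alpha> (E k 0)) $$ (i, q) = (\<alpha> U * g) $$ (i, k)"
      using ik pq by (simp add: g_def scalar_prod_def)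
    moreover have "(\<Sum>r<n. U $$ (r, k) * \<alpha> (E r 0) $$ (i, q)) = (g * U) $$ (i, k)"
      using ik pq U by (simp add: g_def scalar_prod_def lessThan_atLeast0 mult.commute)
    ultimately show "(\<alpha> U * g) $$ (i, k) = (g * U) $$ (i, k)" by simp
  qed (use U g in simp_all)
  \<comment> \<open>By the intertwining relation the kernel of \<open>g\<close> is stable under all
    matrices. From a nonzero kernel vector \<open>c\<close>, the matrix \<open>E 0 i\<close> makes a
    nonzero multiple of the first unit vector, but column 0 of \<open>g\<close> is nonzero.\<close>
  have "det g \<noteq> 0"
  proof
    assume "det g = 0"
    then obtain c where c: "c \<in> carrier_vec n" "c \<noteq> 0\<^sub>v n" "g *\<^sub>v c = 0\<^sub>v n"
      using det_0_iff_vec_prod_zero_field[OF g] by blast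
    then obtain i where i: "i < n" "c $ i \<noteq> 0"
      by (metis carrier_vecD eq_vecI index_zero_vec(1) index_zero_vec(2))
    have "g *\<^sub>v (E 0 i *\<^sub>v c) = (g * E 0 i) *\<^sub>v c"
      using g c by (simp add: assoc_mult_mat_vec[of _ n n _ n])
    also have "\<dots> = \<alpha> (E 0 i) *\<^sub>v (g *\<^sub>v c)"
      using g c inter[of "E 0 i"] by (metis E(1) \<alpha>_carrier(1) assoc_mult_mat_vec)
    also have "\<dots> = 0\<^sub>v n" unfolding c(3) by (rule eq_vecI) (auto simp: scalar_prod_def)
    finally have zero: "g *\<^sub>v (E 0 i *\<^sub>v c) = 0\<^sub>v n" .
    have Ec: "(E 0 i *\<^sub>v c) $ r = (if r = 0 then c $ i else 0)" if "r < n" for r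
    proof -
      have "(E 0 i *\<^sub>v c) $ r = (\<Sum>l = 0..<n. E 0 i $$ (r, l) * c $ l)"
        using that c(1) by (simp add: scalar_prod_def)
      also have "\<dots> = (\<Sum>l = 0..<n. if l = i then (if r = 0 then c $ i else 0) else 0)"
        by (rule sum.cong) (use that in \<open>auto simp: E_def\<close>)
      finally show ?thesis using i by simp
    qed
    have "(g *\<^sub>v (E 0 i *\<^sub>v c)) $ p = (\<Sum>r = 0..<n. g $$ (p, r) * (E 0 i *\<^sub>v c) $ r)"
      using pq g by (simp add: scalar_prod_def)
    also have "\<dots> = (\<Sum>r = 0..<n. if r = 0 then g $$ (p, 0) * c $ i else 0)"
      by (rule sum.cong) (simp_all add: Ec del: index_mult_mat_vec)
    also have "\<dots> = \<alpha> (E 0 0) $$ (p, q) * c $ i" using n pq by (simp add: g_def)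
    finally show False using zero pq i by simp
  qed
  moreover have "det (\<alpha> U) * det g = det g * det U" if "U \<in> carrier_mat n n" for U
    using inter[OF that] det_mult[of "\<alpha> U" n g] det_mult[of g n U] g that by auto
  ultimately show ?thesis using \<alpha>_\<phi>[of d] by (metis lincomb_carrier(1) mult.commute mult_cancel_left)
qed

section \<open>Homomorphisms from an algebra to matrices\<close>

lemma finsum_ring_mat:
  fixes Z :: "'b \<Rightarrow> 'l::field mat"
  assumes "finite B" "\<And>b. b \<in> B \<Longrightarrow> Z b \<in> carrier_mat n n"
  shows "finsum (ring_mat TYPE('l) n ()) (\<lambda>b. c b \<cdot>\<^sub>m Z b) B = lincomb n B c Z"
proof -
  interpret M: Ring.ring "ring_mat TYPE('l) n ()" by (rule ring_mat)
  show ?thesis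
    using assms
  proof (induction B rule: finite_induct)
    case empty
    show ?case by (rule eq_matI) (auto simp: ring_mat_simps)
  next
    case (insert b B)
    then have "finsum (ring_mat TYPE('l) n ()) (\<lambda>b. c b \<cdot>\<^sub>m Z b) (insert b B) = c b \<cdot>\<^sub>m Z b + lincomb n B c Z"
      by (subst M.finsum_insert) (auto simp: ring_mat_simps)
    also have "\<dots> = lincomb n (insert b B) c Z"
      using insert carrier_matD[of "Z b" n n] by (intro eq_matI) auto
    finally show ?case .
  qed
qed

lemma ring_hom_mat_finsum:
  fixes \<phi> :: "'a \<Rightarrow> 'l::field mat"
  assumes A: "abelian_monoid A" and \<phi>: "\<phi> \<in> Ring.ring_hom A (ring_mat TYPE('l) n ())"
    and "finite B" "\<And>b. b \<in> B \<Longrightarrow> Z b \<in> carrier A"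
  shows "\<phi> (finsum A Z B) = lincomb n B (\<lambda>_. 1) (\<lambda>b. \<phi> (Z b))"
proof -
  interpret A: abelian_monoid A by fact
  have carrier: "\<phi> a \<in> carrier_mat n n" if "a \<in> carrier A" for a
    using Ring.ring_hom_closed[OF \<phi> that] by (simp add: ring_mat_simps)
  have add: "\<phi> (a \<oplus>\<^bsub>A\<^esub> a') = \<phi> a + \<phi> a'" if "a \<in> carrier A" "a' \<in> carrier A" for a a'
    using Ring.ring_hom_add[OF \<phi> that] by (simp add: ring_mat_simps)
  \<comment> \<open>\<open>ring_hom\<close> only demands compatibility with sums, products and one;
    that zero goes to zero follows by cancelling in
    \<open>\<phi> 0 + \<phi> 0 = \<phi> 0\<close>.\<close>
  have zero: "\<phi> \<zero>\<^bsub>A\<^esub> = 0\<^sub>m n n"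
  proof (rule eq_matI)
    fix i j assume "i < dim_row (0\<^sub>m n n :: 'l mat)" "j < dim_col (0\<^sub>m n n :: 'l mat)"
    then have "(\<phi> \<zero>\<^bsub>A\<^esub> + \<phi> \<zero>\<^bsub>A\<^esub>) $$ (i, j) = \<phi> \<zero>\<^bsub>A\<^esub> $$ (i, j) + \<phi> \<zero>\<^bsub>A\<^esub> $$ (i, j)" "i < n" "j < n"
      using carrier[OF A.zero_closed] by auto
    then show "\<phi> \<zero>\<^bsub>A\<^esub> $$ (i, j) = 0\<^sub>m n n $$ (i, j)"
      using add[of "\<zero>\<^bsub>A\<^esub>" "\<zero>\<^bsub>A\<^esub>"]
      by (metis A.l_zero A.zero_closed add_cancel_right_right index_zero_mat(1))
  qed (use carrier[OF A.zero_closed] in auto)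
  show ?thesis
    using assms(3,4)
  proof (induction B rule: finite_induct)
    case empty
    show ?case by (rule eq_matI) (auto simp: zero)
  next
    case (insert b B)
    then have "\<phi> (finsum A Z (insert b B)) = \<phi> (Z b) + lincomb n B (\<lambda>_. 1) (\<lambda>b. \<phi> (Z b))"
      by (subst A.finsum_insert) (auto simp: add A.finsum_closed)
    also have "\<dots> = lincomb n (insert b B) (\<lambda>_. 1) (\<lambda>b. \<phi> (Z b))"
      using insert carrier[of "Z b"] by (intro eq_matI) auto
    finally show ?case .
  qed
qed

locale algebra_to_matrices = abelian_monoid A for A (structure) +
  fixes s :: "'k::field \<Rightarrow> 'a" and n :: nat
  assumes n: "0 < n"
    and m_closed: "a \<in> carrier A \<Longrightarrow> a' \<in> carrier A \<Longrightarrow> a \<otimes> a' \<in> carrier A"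
    and one_closed: "\<one> \<in> carrier A"
    and s_closed: "s c \<in> carrier A"
begin

lemma hom_combination:
  assumes \<phi>: "\<phi> \<in> Ring.ring_hom A (ring_mat TYPE('k alg_closure) n ())"
    and s: "\<And>c. \<phi> (s c) = to_ac c \<cdot>\<^sub>m 1\<^sub>m n"
    and B: "finite B" "B \<subseteq> carrier A"
  shows "\<phi> (\<Oplus>b\<in>B. s (c b) \<otimes> b) = lincomb n B (\<lambda>b. to_ac (c b)) \<phi>"
proof -
  have "\<phi> (\<Oplus>b\<in>B. s (c b) \<otimes> b) = lincomb n B (\<lambda>_. 1) (\<lambda>b. \<phi> (s (c b) \<otimes> b))"
    using B by (intro ring_hom_mat_finsum[OF abelian_monoid_axioms \<phi>]) (auto intro!: m_closed s_closed)
  also have "\<dots> = lincomb n B (\<lambda>_. 1) (\<lambda>b. to_ac (c b) \<cdot>\<^sub>m \<phi> b)"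
  proof (rule lincomb_cong)
    fix b assume "b \<in> B"
    then have b: "b \<in> carrier A" using B by auto
    have \<phi>b: "\<phi> b \<in> carrier_mat n n"
      using Ring.ring_hom_closed[OF \<phi> b] by (simp add: ring_mat_simps)
    have "\<phi> (s (c b) \<otimes> b) = (to_ac (c b) \<cdot>\<^sub>m 1\<^sub>m n) * \<phi> b"
      using Ring.ring_hom_mult[OF \<phi> s_closed b] by (simp add: ring_mat_simps s)
    also have "\<dots> = to_ac (c b) \<cdot>\<^sub>m \<phi> b"
      using \<phi>b by (simp add: mult_smult_assoc_mat[of _ n n _ n])
    finally show "\<phi> (s (c b) \<otimes> b) = to_ac (c b) \<cdot>\<^sub>m \<phi> b" .
  qed simp
  also have "\<dots> = lincomb n B (\<lambda>b. to_ac (c b)) \<phi>"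
  proof (rule eq_matI)
    fix p q assume "p < dim_row (lincomb n B (\<lambda>b. to_ac (c b)) \<phi>)" "q < dim_col (lincomb n B (\<lambda>b. to_ac (c b)) \<phi>)"
    moreover have "dim_row (\<phi> b) = n" "dim_col (\<phi> b) = n" if "b \<in> B" for b
      using Ring.ring_hom_closed[OF \<phi>, of b] that B by (auto simp: ring_mat_simps)
    ultimately show "lincomb n B (\<lambda>_. 1) (\<lambda>b. to_ac (c b) \<cdot>\<^sub>m \<phi> b) $$ (p, q)
        = lincomb n B (\<lambda>b. to_ac (c b)) \<phi> $$ (p, q)"
      by (auto intro!: sum.cong)
  qed simp_all
  finally show ?thesis .
qed

text \<open>A k-basis of \<open>A\<close> expresses 1 and all products of basis elements with
  coefficients in k. Both homomorphisms carry these expressions to the same combinations of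
  matrices, so \<open>det_lincomb_eq\<close> applies.\<close>

lemma splitting_det_unique:
  assumes split: "splitting A s n \<phi>"
    and \<psi>: "\<psi> \<in> Ring.ring_hom A (ring_mat TYPE('k alg_closure) n ())"
    and \<psi>s: "\<And>c. \<psi> (s c) = to_ac c \<cdot>\<^sub>m 1\<^sub>m n"
    and a: "a \<in> carrier A"
  shows "det (\<phi> a) = det (\<psi> a)"
proof -
  let ?M = "ring_mat TYPE('k alg_closure) n ()"
  have \<phi>: "\<phi> \<in> Ring.ring_hom A ?M" and \<phi>s: "\<And>c. \<phi> (s c) = to_ac c \<cdot>\<^sub>m 1\<^sub>m n"
    using split unfolding splitting_def by (auto simp: Let_def)
  obtain B where B: "finite B" "B \<subseteq> carrier A"
    and basisA: "\<forall>a\<in>carrier A. \<exists>!c. c \<in> B \<rightarrow>\<^sub>E UNIV \<and> a = (\<Oplus>b\<in>B. s (c b) \<otimes> b)"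
    and basisM: "\<forall>U\<in>carrier ?M. \<exists>!c. c \<in> B \<rightarrow>\<^sub>E UNIV \<and> U = (\<Oplus>\<^bsub>?M\<^esub>b\<in>B. c b \<cdot>\<^sub>m \<phi> b)"
    using split unfolding splitting_def Let_def by blast
  have carrier: "\<phi> a \<in> carrier_mat n n" "\<psi> a \<in> carrier_mat n n" if "a \<in> carrier A" for a
    using Ring.ring_hom_closed[OF \<phi> that] Ring.ring_hom_closed[OF \<psi> that] by (simp_all add: ring_mat_simps)
  have common: "\<exists>d. \<phi> a = lincomb n B d \<phi> \<and> \<psi> a = lincomb n B d \<psi>" if "a \<in> carrier A" for a
  proof -
    obtain c where "a = (\<Oplus>b\<in>B. s (c b) \<otimes> b)" using basisA \<open>a \<in> carrier A\<close> by metis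
    then show ?thesis
      using hom_combination[OF \<phi> \<phi>s B, of c] hom_combination[OF \<psi> \<psi>s B, of c] by auto
  qed
  have "det (lincomb n B d \<phi>) = det (lincomb n B d \<psi>)" for d
  proof (rule det_lincomb_eq[OF n])
    show "\<phi> b \<in> carrier_mat n n" "\<psi> b \<in> carrier_mat n n" if "b \<in> B" for b
      using carrier that B by auto
    show "\<exists>d. \<phi> a * \<phi> b = lincomb n B d \<phi> \<and> \<psi> a * \<psi> b = lincomb n B d \<psi>" if "a \<in> B" "b \<in> B" for a b
    proof -
      have ab: "a \<in> carrier A" "b \<in> carrier A" using that B by auto
      show ?thesis
        using common[OF m_closed[OF ab]] Ring.ring_hom_mult[OF \<phi> ab] Ring.ring_hom_mult[OF \<psi> ab]
        by (simp add: ring_mat_simps)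
    qed
    show "\<exists>d. 1\<^sub>m n = lincomb n B d \<phi> \<and> 1\<^sub>m n = lincomb n B d \<psi>"
      using common[OF one_closed] Ring.ring_hom_one[OF \<phi>] Ring.ring_hom_one[OF \<psi>]
      by (simp add: ring_mat_simps)
    show "\<exists>!c. c \<in> B \<rightarrow>\<^sub>E UNIV \<and> U = lincomb n B c \<phi>" if "U \<in> carrier_mat n n" for U
    proof -
      have "(\<Oplus>\<^bsub>?M\<^esub>b\<in>B. c b \<cdot>\<^sub>m \<phi> b) = lincomb n B c \<phi>" for c
        using carrier B by (intro finsum_ring_mat) auto
      then show ?thesis using basisM that by (simp add: ring_mat_simps)
    qed
  qed
  then show ?thesis using common[OF a] by metis
qed

end

section \<open>The split representation\<close>

lemma sum_swap_pairs:
  "(\<Sum>i\<in>I. \<Sum>j\<in>J. \<Sum>p\<in>P. \<Sum>q\<in>Q. h i j p q) = (\<Sum>p\<in>P. \<Sum>q\<in>Q. \<Sum>i\<in>I. \<Sum>j\<in>J. h i j p q)"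
proof -
  have "(\<Sum>i\<in>I. \<Sum>j\<in>J. \<Sum>p\<in>P. \<Sum>q\<in>Q. h i j p q) = (\<Sum>i\<in>I. \<Sum>p\<in>P. \<Sum>j\<in>J. \<Sum>q\<in>Q. h i j p q)"
    by (rule sum.cong[OF refl], rule sum.swap)
  also have "\<dots> = (\<Sum>p\<in>P. \<Sum>i\<in>I. \<Sum>j\<in>J. \<Sum>q\<in>Q. h i j p q)"
    by (rule sum.swap)
  also have "\<dots> = (\<Sum>p\<in>P. \<Sum>i\<in>I. \<Sum>q\<in>Q. \<Sum>j\<in>J. h i j p q)"
    by (rule sum.cong[OF refl], rule sum.cong[OF refl], rule sum.swap)
  also have "\<dots> = (\<Sum>p\<in>P. \<Sum>q\<in>Q. \<Sum>i\<in>I. \<Sum>j\<in>J. h i j p q)"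
    by (rule sum.cong[OF refl], rule sum.swap)
  finally show ?thesis .
qed

context cyclic_data
begin

abbreviation emb :: "'f poly \<Rightarrow> 'f poly fract alg_closure" where
  "emb p \<equiv> to_ac (to_fract p)"

definition root_x :: "'f poly fract alg_closure" where
  "root_x = (SOME y. y ^ n = emb [:0, 1:])"

lemma root_x_power: "root_x ^ n = emb [:0, 1:]"
  unfolding root_x_def by (rule someI_ex) (rule nth_root_exists[OF n_pos])

lemma root_x_nonzero: "root_x \<noteq> 0"
proof
  assume "root_x = 0"
  then have "emb [:0, 1:] = 0" using root_x_power n_pos by (metis zero_power)
  then show False by simp
qed

sublocale const: comm_ring_hom "\<lambda>c. emb [:c:]"
  by unfold_locales (simp_all flip: to_fract_add to_ac_add to_fract_mult to_ac_mult one_pCons)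

definition ev :: "'f poly \<Rightarrow> 'f poly fract alg_closure" where
  "ev p = poly (map_poly (\<lambda>c. emb [:c:]) p) root_x"

sublocale ev: comm_ring_hom ev
proof
  interpret m: map_poly_comm_ring_hom "\<lambda>c. emb [:c:] :: 'f poly fract alg_closure" ..
  show "ev 0 = 0" "ev 1 = 1" "ev (p + q) = ev p + ev q" "ev (p * q) = ev p * ev q" for p q
    by (simp_all add: ev_def m.hom_add m.hom_mult)
qed

lemma ev_monom: "ev (monom c k) = emb [:c:] * root_x ^ k"
  by (simp add: ev_def map_poly_monom poly_monom)

lemma ev_const: "ev [:c:] = emb [:c:]"
  using ev_monom[of c 0] by (simp add: monom_0)

text \<open>\<open>T\<close> goes to the \<open>n\<close>-th root \<open>y\<close> of
  \<open>x\<close>, so a polynomial in \<open>T^n\<close> returns to the image of F[x].\<close>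

lemma ev_pcompose: "ev (pcompose p (monom 1 n)) = emb p"
proof (induction p)
  case (pCons a p)
  have "pCons a p = [:a:] + [:0, 1:] * p" by simp
  then have "emb (pCons a p) = emb [:a:] + emb [:0, 1:] * emb p"
    by (metis to_ac_add to_ac_mult to_fract_add to_fract_mult)
  then show ?case
    by (simp add: pcompose_pCons ev.hom_add ev.hom_mult ev_const ev_monom pCons.IH root_x_power flip: one_pCons)
qed simp

text \<open>Since \<open>x\<close> gets an \<open>n\<close>-th root \<open>y\<close> in the algebraic closure, the maximal subfield
  \<open>F(t)\<close> embeds by \<open>t \<mapsto> y\<close>; this is the resulting split representation on \<open>K\<close>.\<close>

definition rep :: "'k poly \<Rightarrow> 'f poly fract alg_closure mat" where
  "rep f = map_mat ev (reg f)"

lemma rep_carrier [simp]: "rep f \<in> carrier_mat n n" "dim_row (rep f) = n" "dim_col (rep f) = n"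
  by (simp_all add: rep_def)

lemma rep_add: "rep (f + g) = rep f + rep g"
  unfolding rep_def reg_add by (rule eq_matI) (simp_all add: ev.hom_add)

lemma rep_mult: "rep (skew_mult \<sigma> f g) = rep f * rep g"
  unfolding rep_def reg_mult by (rule ev.mat_hom_mult[of _ n n _ n]) simp_all

lemma rep_center: "rep (center_emb \<iota> n p) = emb p \<cdot>\<^sub>m 1\<^sub>m n"
  unfolding rep_def reg_center by (rule eq_matI) (simp_all add: ev_pcompose)

lemma rep_center_mult: "rep (skew_mult \<sigma> (center_emb \<iota> n p) g) = emb p \<cdot>\<^sub>m rep g"
  by (simp add: rep_mult rep_center mult_smult_assoc_mat[of _ n n _ n])

lemma rep_mult_center: "rep (skew_mult \<sigma> g (center_emb \<iota> n p)) = emb p \<cdot>\<^sub>m rep g"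
  by (simp add: rep_mult rep_center mult_smult_distrib[of _ n n _ n])

lemma rep_1: "rep 1 = 1\<^sub>m n"
proof -
  have "center_emb \<iota> n 1 = 1" by (simp add: center_emb_def)
  then show ?thesis using rep_center[of 1] by (intro eq_matI) auto
qed

lemma rep_0: "rep 0 = 0\<^sub>m n n"
proof -
  have "center_emb \<iota> n 0 = 0" by (simp add: center_emb_def)
  then show ?thesis using rep_center[of 0] by (intro eq_matI) auto
qed

lemma rep_sum:
  assumes "finite S"
  shows "rep (\<Sum>x\<in>S. h x) = lincomb n S (\<lambda>_. 1) (\<lambda>x. rep (h x))"
  using assms
proof (induction S rule: finite_induct)
  case empty
  show ?case by (rule eq_matI) (auto simp: rep_0)
next
  case (insert x S)
  then show ?case by (intro eq_matI) (auto simp: rep_add)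
qed

section \<open>A basis of the matrix algebra over the algebraic closure\<close>

definition basis_monom :: "nat \<times> nat \<Rightarrow> 'k poly" where
  "basis_monom ij = monom (b (snd ij)) (fst ij)"

abbreviation idx :: "(nat \<times> nat) set" where
  "idx \<equiv> {..<n} \<times> {..<n}"

lemma rep_basis_monom:
  assumes "p < n" "q < n"
  shows "rep (basis_monom (i, j)) $$ (p, q) = emb [:crd p (b j * (\<sigma> ^^ i) (b q)):] * root_x ^ i"
proof -
  have "reg (basis_monom (i, j)) $$ (p, q) = monom (crd p (b j * (\<sigma> ^^ i) (b q))) i"
    by (rule poly_eqI) (use assms in \<open>auto simp: coeff_reg basis_monom_def coeff_monom\<close>)
  then show ?thesis using assms by (simp add: rep_def ev_monom)
qed

text \<open>By \<open>WV\<close>, the functional \<open>crd q\<close> followed by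
  \<open>\<iota>\<close> is the sum of the \<open>W q i \<sigma>^i\<close>. The matrix unit at
  \<open>(p, q)\<close> is therefore the sum of the operators \<open>b_p W q i \<sigma>^i\<close>,
  and \<open>dual i j p q\<close> is its coefficient at \<open>b_j \<sigma>^i\<close>.\<close>

definition dual :: "nat \<Rightarrow> nat \<Rightarrow> nat \<Rightarrow> nat \<Rightarrow> 'f" where
  "dual i j p q = crd j (b p * W q i)"

lemma crd_expand: "j < n \<Longrightarrow> crd j (\<Sum>p<n. \<iota> (c p) * b p) = c j"
proof -
  assume j: "j < n"
  have "crd j (\<Sum>p<n. \<iota> (c p) * b p) = (\<Sum>p<n. if p = j then c p else 0)"
    unfolding crd_sum crd_scale by (rule sum.cong) (auto simp: crd_basis j)
  then show ?thesis using j by simp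
qed

text \<open>The sum over \<open>p\<close> reassembles \<open>b j' * (\<sigma> ^^ i') (b q)\<close>
  from its coordinates; \<open>VW\<close> then evaluates the sum over \<open>q\<close>.\<close>

lemma dual_left:
  assumes "i < n" "j < n" "i' < n" "j' < n"
  shows "(\<Sum>p<n. \<Sum>q<n. dual i j p q * crd p (b j' * (\<sigma> ^^ i') (b q))) = (if i = i' \<and> j = j' then 1 else 0)"
proof -
  have "(\<Sum>p<n. \<Sum>q<n. dual i j p q * crd p (b j' * (\<sigma> ^^ i') (b q)))
      = crd j (\<Sum>q<n. (\<Sum>p<n. \<iota> (crd p (b j' * (\<sigma> ^^ i') (b q))) * b p) * W q i)"
    unfolding sum_distrib_right crd_sum
    by (subst sum.swap) (simp add: dual_def crd_scale mult.assoc mult.commute[of "crd j _"])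
  also have "\<dots> = crd j (b j' * (\<Sum>q<n. (\<sigma> ^^ i') (b q) * W q i))"
    unfolding expand by (simp add: sum_distrib_left mult.assoc)
  also have "\<dots> = (if i = i' \<and> j = j' then 1 else 0)"
    using assms by (auto simp: VW crd_basis)
  finally show ?thesis .
qed

text \<open>Here the sum over \<open>j\<close> reassembles \<open>b p' * W q' i\<close>, and
  \<open>WV\<close> evaluates the sum over \<open>i\<close>.\<close>

lemma dual_right:
  assumes "p < n" "q < n" "p' < n" "q' < n"
  shows "(\<Sum>i<n. \<Sum>j<n. crd p (b j * (\<sigma> ^^ i) (b q)) * dual i j p' q') = (if p = p' \<and> q = q' then 1 else 0)"
proof -
  have "(\<Sum>i<n. \<Sum>j<n. crd p (b j * (\<sigma> ^^ i) (b q)) * dual i j p' q')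
      = crd p (\<Sum>i<n. (\<Sum>j<n. \<iota> (crd j (b p' * W q' i)) * b j) * (\<sigma> ^^ i) (b q))"
    unfolding sum_distrib_right crd_sum
    by (simp add: dual_def crd_scale mult.assoc mult.commute[of "crd p _"])
  also have "\<dots> = crd p (b p' * (\<Sum>i<n. W q' i * (\<sigma> ^^ i) (b q)))"
    unfolding expand by (simp add: sum_distrib_left mult.assoc)
  also have "\<dots> = (if p = p' \<and> q = q' then 1 else 0)"
    using assms by (auto simp: WV crd_basis)
  finally show ?thesis .
qed

text \<open>The division undoes the factor \<open>y^i\<close> that comes from letting
  \<open>t\<close> act as \<open>y \<sigma>\<close>.\<close>

definition coord :: "'f poly fract alg_closure mat \<Rightarrow> nat \<times> nat \<Rightarrow> 'f poly fract alg_closure" where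
  "coord U ij = (\<Sum>p<n. \<Sum>q<n. emb [:dual (fst ij) (snd ij) p q:] * U $$ (p, q)) / root_x ^ fst ij"

lemma coord_mult_root:
  "coord U (i, j) * root_x ^ i = (\<Sum>p<n. \<Sum>q<n. emb [:dual i j p q:] * U $$ (p, q))"
  using root_x_nonzero by (simp add: coord_def)

lemma index_lincomb_idx:
  assumes "p < n" "q < n"
  shows "lincomb n idx c (\<lambda>ij. rep (basis_monom ij)) $$ (p, q)
    = (\<Sum>i<n. \<Sum>j<n. emb [:crd p (b j * (\<sigma> ^^ i) (b q)):] * (c (i, j) * root_x ^ i))"
proof -
  have "lincomb n idx c (\<lambda>ij. rep (basis_monom ij)) $$ (p, q)
      = (\<Sum>i<n. \<Sum>j<n. c (i, j) * rep (basis_monom (i, j)) $$ (p, q))"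
    using assms by (simp add: sum.cartesian_product)
  then show ?thesis using assms by (simp add: rep_basis_monom ac_simps)
qed

lemma lincomb_coord:
  assumes U: "U \<in> carrier_mat n n"
  shows "lincomb n idx (coord U) (\<lambda>ij. rep (basis_monom ij)) = U"
proof (rule eq_matI)
  fix p q assume "p < dim_row U" "q < dim_col U"
  then have pq: "p < n" "q < n" using U by auto
  have "lincomb n idx (coord U) (\<lambda>ij. rep (basis_monom ij)) $$ (p, q)
      = (\<Sum>i<n. \<Sum>j<n. emb [:crd p (b j * (\<sigma> ^^ i) (b q)):] * (coord U (i, j) * root_x ^ i))"
    by (rule index_lincomb_idx[OF pq])
  also have "\<dots> = (\<Sum>i<n. \<Sum>j<n. \<Sum>p'<n. \<Sum>q'<n.
      emb [:crd p (b j * (\<sigma> ^^ i) (b q)) * dual i j p' q':] * U $$ (p', q'))"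
    by (simp only: coord_mult_root const.hom_mult sum_distrib_left mult.assoc)
  also have "\<dots> = (\<Sum>p'<n. \<Sum>q'<n. \<Sum>i<n. \<Sum>j<n.
      emb [:crd p (b j * (\<sigma> ^^ i) (b q)) * dual i j p' q':] * U $$ (p', q'))"
    by (rule sum_swap_pairs)
  also have "\<dots> = (\<Sum>p'<n. \<Sum>q'<n.
      emb [:\<Sum>i<n. \<Sum>j<n. crd p (b j * (\<sigma> ^^ i) (b q)) * dual i j p' q':] * U $$ (p', q'))"
    by (simp add: const.hom_sum sum_distrib_right)
  also have "\<dots> = (\<Sum>p'<n. \<Sum>q'<n. if q' = q then (if p' = p then U $$ (p, q) else 0) else 0)"
    by (intro sum.cong refl) (use pq in \<open>auto simp: dual_right\<close>)
  also have "\<dots> = U $$ (p, q)" using pq by simp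
  finally show "lincomb n idx (coord U) (\<lambda>ij. rep (basis_monom ij)) $$ (p, q) = U $$ (p, q)" .
qed (use U in simp_all)

lemma coord_lincomb:
  assumes ij: "ij \<in> idx"
  shows "coord (lincomb n idx c (\<lambda>ij. rep (basis_monom ij))) ij = c ij"
proof -
  obtain i j where [simp]: "ij = (i, j)" and ij: "i < n" "j < n" using ij by (cases ij) auto
  have "(\<Sum>p<n. \<Sum>q<n. emb [:dual i j p q:] * lincomb n idx c (\<lambda>ij. rep (basis_monom ij)) $$ (p, q))
      = (\<Sum>p<n. \<Sum>q<n. \<Sum>i'<n. \<Sum>j'<n.
          emb [:dual i j p q * crd p (b j' * (\<sigma> ^^ i') (b q)):] * (c (i', j') * root_x ^ i'))"
    by (intro sum.cong refl)
      (simp only: index_lincomb_idx lessThan_iff const.hom_mult sum_distrib_left mult.assoc)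
  also have "\<dots> = (\<Sum>i'<n. \<Sum>j'<n. \<Sum>p<n. \<Sum>q<n.
          emb [:dual i j p q * crd p (b j' * (\<sigma> ^^ i') (b q)):] * (c (i', j') * root_x ^ i'))"
    by (rule sum_swap_pairs)
  also have "\<dots> = (\<Sum>i'<n. \<Sum>j'<n.
          emb [:\<Sum>p<n. \<Sum>q<n. dual i j p q * crd p (b j' * (\<sigma> ^^ i') (b q)):] * (c (i', j') * root_x ^ i'))"
    by (simp add: const.hom_sum sum_distrib_right)
  also have "\<dots> = (\<Sum>i'<n. \<Sum>j'<n. if j' = j then (if i' = i then c (i, j) * root_x ^ i else 0) else 0)"
    by (intro sum.cong refl) (use ij in \<open>auto simp: dual_left\<close>)
  also have "\<dots> = c (i, j) * root_x ^ i" using ij by simp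
  finally show ?thesis using root_x_nonzero by (simp add: coord_def)
qed

section \<open>Skew polynomials as a free module over the center\<close>

text \<open>This is the coefficient in F[x] of f at the basis element \<open>b_j t^i\<close>.
  Summing up to \<open>degree f\<close> is a generous bound, as the exponent
  \<open>i + n * k\<close> is at least \<open>k\<close>.\<close>

definition part :: "'k poly \<Rightarrow> nat \<times> nat \<Rightarrow> 'f poly" where
  "part f ij = (\<Sum>k\<le>degree f. monom (crd (snd ij) (coeff f (fst ij + n * k))) k)"

lemma coeff_part: "coeff (part f (i, j)) k = crd j (coeff f (i + n * k))"
proof -
  have "degree f < i + n * k" if "degree f < k"
  proof -
    have "k \<le> n * k" using n_pos by simp
    then show ?thesis using that by linarith
  qed
  then show ?thesis by (auto simp: part_def coeff_sum coeff_monom coeff_eq_0 not_le)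
qed

lemma coeff_center_mult_monom:
  "coeff (skew_mult \<sigma> (center_emb \<iota> n p) (monom c i)) l
    = (if i \<le> l \<and> n dvd l - i then \<iota> (coeff p ((l - i) div n)) * c else 0)"
proof -
  have \<sigma>_dvd: "(\<sigma> ^^ k) a = a" if "n dvd k" for k a
    using \<sigma>_mod[of k a] that by simp
  have "coeff (skew_mult \<sigma> (center_emb \<iota> n p) (monom c i)) l
      = (\<Sum>r\<le>l. if r = l - i then (if i \<le> l \<and> n dvd l - i then \<iota> (coeff p ((l - i) div n)) * c else 0) else 0)"
    unfolding coeff_skew_mult[OF hom_\<sigma>]
    by (rule sum.cong) (auto simp: coeff_center_emb coeff_monom \<sigma>_dvd)
  then show ?thesis by simp
qed

text \<open>Division of the exponent by \<open>n\<close> splits off a power of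
  \<open>x = t^n\<close>, and the coefficient in K is expanded in the basis
  \<open>b\<close>.\<close>

lemma decompose:
  "f = (\<Sum>ij\<in>idx. skew_mult \<sigma> (center_emb \<iota> n (part f ij)) (basis_monom ij))"
proof (rule poly_eqI)
  fix l
  have "coeff (\<Sum>ij\<in>idx. skew_mult \<sigma> (center_emb \<iota> n (part f ij)) (basis_monom ij)) l
      = (\<Sum>i<n. \<Sum>j<n. if i \<le> l \<and> n dvd l - i then \<iota> (coeff (part f (i, j)) ((l - i) div n)) * b j else 0)"
    by (simp add: coeff_sum sum.cartesian_product basis_monom_def coeff_center_mult_monom case_prod_unfold cong: if_cong)
  also have "\<dots> = (\<Sum>i<n. if i = l mod n then coeff f l else 0)"
  proof (rule sum.cong)
    fix i assume i: "i \<in> {..<n}"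
    show "(\<Sum>j<n. if i \<le> l \<and> n dvd l - i then \<iota> (coeff (part f (i, j)) ((l - i) div n)) * b j else 0)
        = (if i = l mod n then coeff f l else 0)"
    proof (cases "i = l mod n")
      case True
      then have "i \<le> l" "n dvd l - i" "i + n * ((l - i) div n) = l"
        by (auto simp: minus_mod_eq_mult_div)
      then show ?thesis using True expand[of "coeff f l"] by (simp add: coeff_part)
    next
      case False
      \<comment> \<open>For an index \<open>i\<close> below \<open>n\<close>, divisibility of
        \<open>l - i\<close> by \<open>n\<close> forces \<open>i\<close> to be the remainder of
        \<open>l\<close>.\<close>
      then have "\<not> (i \<le> l \<and> n dvd l - i)"
        using i by (metis lessThan_iff mod_eq_dvd_iff_nat mod_less)
      then show ?thesis using False by auto
    qed
  qed simp
  also have "\<dots> = coeff f l" using n_pos by simp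
  finally show "coeff f l = coeff (\<Sum>ij\<in>idx. skew_mult \<sigma> (center_emb \<iota> n (part f ij)) (basis_monom ij)) l" ..
qed

lemma rep_decompose: "rep f = lincomb n idx (\<lambda>ij. emb (part f ij)) (\<lambda>ij. rep (basis_monom ij))"
proof -
  have "rep f = lincomb n idx (\<lambda>_. 1) (\<lambda>ij. emb (part f ij) \<cdot>\<^sub>m rep (basis_monom ij))"
    by (subst decompose[of f], subst rep_sum) (simp_all add: rep_center_mult)
  also have "\<dots> = lincomb n idx (\<lambda>ij. emb (part f ij)) (\<lambda>ij. rep (basis_monom ij))"
    by (rule eq_matI) auto
  finally show ?thesis .
qed

text \<open>The coordinates of \<open>rep f\<close> in the basis are the images of the polynomials
  \<open>part f ij\<close>, which determine \<open>f\<close>.\<close>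

lemma rep_inject: "rep f = rep g \<longleftrightarrow> f = g"
proof
  assume "rep f = rep g"
  moreover have "coord (rep h) ij = emb (part h ij)" if "ij \<in> idx" for h ij
    unfolding rep_decompose[of h] by (rule coord_lincomb[OF that])
  ultimately have "part f ij = part g ij" if "ij \<in> idx" for ij
    using that by (metis to_ac_eq_iff to_fract_eq_iff)
  then show "f = g" by (subst decompose[of f], subst decompose[of g]) (auto intro!: sum.cong)
qed simp

lemma det_rep:
  assumes "f \<noteq> 0"
  obtains Q where "det (rep f) = emb Q" "degree Q = degree f"
    "coeff Q 0 = field_norm \<iota> (coeff f 0)"
    "coeff Q (degree f) = (-1) ^ (degree f * (n - 1)) * field_norm \<iota> (coeff f (degree f))"
proof -
  obtain Q where Q: "det (reg f) = pcompose Q (monom 1 n)" "degree Q = degree f"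
    "coeff Q 0 = field_norm \<iota> (coeff f 0)"
    "coeff Q (degree f) = (-1) ^ (degree f * (n - 1)) * field_norm \<iota> (coeff f (degree f))"
    by (rule det_reg[OF assms])
  have "det (rep f) = emb Q"
    unfolding rep_def ev.hom_det Q(1) by (rule ev_pcompose)
  then show ?thesis using Q that by blast
qed

end

section \<open>The ring of central quotients\<close>

context cyclic_data
begin

abbreviation A :: "('k poly \<times> 'f poly) set ring" where
  "A \<equiv> central_quotients \<iota> \<sigma> n"

definition frac_rep :: "'k poly \<times> 'f poly \<Rightarrow> 'f poly fract alg_closure mat" where
  "frac_rep fg = inverse (emb (snd fg)) \<cdot>\<^sub>m rep (fst fg)"

lemma frac_rep_carrier [simp]:
  "frac_rep fg \<in> carrier_mat n n" "dim_row (frac_rep fg) = n" "dim_col (frac_rep fg) = n"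
  by (simp_all add: frac_rep_def)

lemma frac_rep_one: "frac_rep (f, 1) = rep f"
  by (rule eq_matI) (simp_all add: frac_rep_def)

text \<open>Denominators act as nonzero scalars and can be cleared; then \<open>rep_inject\<close>
  applies. So \<open>quot_rel\<close> is equality of matrices for fractions, and its classes are the
  fibres.\<close>

lemma frac_rep_eq_iff:
  assumes "g \<noteq> 0" "g' \<noteq> 0"
  shows "frac_rep (f, g) = frac_rep (f', g') \<longleftrightarrow>
    skew_mult \<sigma> f (center_emb \<iota> n g') = skew_mult \<sigma> f' (center_emb \<iota> n g)"
proof -
  have "frac_rep (f, g) = frac_rep (f', g') \<longleftrightarrow> emb g' \<cdot>\<^sub>m rep f = emb g \<cdot>\<^sub>m rep f'"
  proof -
    have eq: "inverse x * u = inverse y * v \<longleftrightarrow> y * u = x * v"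
      if "x \<noteq> 0" "y \<noteq> 0" for x y u v :: "'f poly fract alg_closure"
      using that by (auto simp: field_simps)
    show ?thesis
      using assms unfolding frac_rep_def by (auto simp: mat_eq_iff eq)
  qed
  also have "\<dots> \<longleftrightarrow> rep (skew_mult \<sigma> f (center_emb \<iota> n g')) = rep (skew_mult \<sigma> f' (center_emb \<iota> n g))"
    by (simp only: rep_mult_center)
  finally show ?thesis by (simp only: rep_inject)
qed

text \<open>The elements of \<open>K(t;\<sigma>)\<close> are exactly the fibres of \<open>frac_rep\<close>, so all laws can be checked
  on matrices.\<close>

definition fibre :: "'f poly fract alg_closure mat \<Rightarrow> ('k poly \<times> 'f poly) set" where
  "fibre U = {(f, g). g \<noteq> 0 \<and> frac_rep (f, g) = U}"

lemma quot_eq_fibre: "g \<noteq> 0 \<Longrightarrow> quot \<iota> \<sigma> n f g = fibre (frac_rep (f, g))"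
  unfolding quot_def quot_rel_def fibre_def by (auto simp: frac_rep_eq_iff)

lemma carrier_A: "carrier A = {quot \<iota> \<sigma> n f g | f g. g \<noteq> 0}"
  unfolding central_quotients_def quotient_def quot_def by auto

text \<open>The representative is chosen arbitrarily; on a fibre \<open>frac_rep\<close> is
  constant.\<close>

definition fraction_rep :: "('k poly \<times> 'f poly) set \<Rightarrow> 'f poly fract alg_closure mat" where
  "fraction_rep P = frac_rep (SOME fg. fg \<in> P)"

lemma fraction_rep_fibre:
  assumes "g \<noteq> 0"
  shows "fraction_rep (fibre (frac_rep (f, g))) = frac_rep (f, g)"
proof -
  have "(f, g) \<in> fibre (frac_rep (f, g))" using assms by (simp add: fibre_def)
  then have "(SOME fg. fg \<in> fibre (frac_rep (f, g))) \<in> fibre (frac_rep (f, g))" by (rule someI)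
  then show ?thesis unfolding fraction_rep_def by (auto simp: fibre_def)
qed

lemma fraction_rep_quot: "g \<noteq> 0 \<Longrightarrow> fraction_rep (quot \<iota> \<sigma> n f g) = frac_rep (f, g)"
  by (simp add: quot_eq_fibre fraction_rep_fibre)

lemma fraction_rep_carrier: "P \<in> carrier A \<Longrightarrow> fraction_rep P \<in> carrier_mat n n"
  by (auto simp: carrier_A fraction_rep_quot)

lemma fraction_rep_inject:
  assumes "P \<in> carrier A" "Q \<in> carrier A" "fraction_rep P = fraction_rep Q"
  shows "P = Q"
proof -
  obtain f g f' g' where PQ: "P = quot \<iota> \<sigma> n f g" "g \<noteq> 0" "Q = quot \<iota> \<sigma> n f' g'" "g' \<noteq> 0"
    using assms(1,2) by (auto simp: carrier_A)
  then have "frac_rep (f, g) = frac_rep (f', g')" using assms(3)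
    by (simp only: fraction_rep_quot[OF PQ(2)] fraction_rep_quot[OF PQ(4)])
  then show ?thesis unfolding PQ(1,3) quot_eq_fibre[OF PQ(2)] quot_eq_fibre[OF PQ(4)] by (rule arg_cong)
qed

lemma frac_rep_mult: "frac_rep (skew_mult \<sigma> f f', g * g') = frac_rep (f, g) * frac_rep (f', g')"
proof -
  have "frac_rep (f, g) * frac_rep (f', g') = inverse (emb g') \<cdot>\<^sub>m (inverse (emb g) \<cdot>\<^sub>m (rep f * rep f'))"
    by (simp add: frac_rep_def mult_smult_assoc_mat[of _ n n _ n] mult_smult_distrib[of _ n n _ n])
  also have "\<dots> = frac_rep (skew_mult \<sigma> f f', g * g')"
    by (rule eq_matI) (auto simp: frac_rep_def rep_mult ac_simps)
  finally show ?thesis ..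
qed

lemma frac_rep_add:
  assumes "g \<noteq> 0" "g' \<noteq> 0"
  shows "frac_rep (skew_mult \<sigma> f (center_emb \<iota> n g') + skew_mult \<sigma> f' (center_emb \<iota> n g), g * g')
    = frac_rep (f, g) + frac_rep (f', g')"
proof -
  have "inverse (x * y) * (y * u + x * v) = inverse x * u + inverse y * v"
    if "x \<noteq> 0" "y \<noteq> 0" for x y u v :: "'f poly fract alg_closure"
  proof -
    have "inverse (x * y) * (y * u + x * v) = inverse x * ((inverse y * y) * u) + inverse y * ((inverse x * x) * v)"
      by (simp only: inverse_mult_distrib distrib_left ac_simps)
    then show ?thesis by (simp only: left_inverse[OF that(1)] left_inverse[OF that(2)] mult_1_left)
  qed
  then show ?thesis
    using assms unfolding frac_rep_def by (intro eq_matI) (simp_all add: rep_add rep_mult_center)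
qed

text \<open>The operations of \<open>central_quotients\<close> are unions over all representatives.
  When every choice gives the same class, the union over these nonempty sets is that class.\<close>

lemma union_over_fibres:
  assumes "g \<noteq> 0" "g' \<noteq> 0"
    and "\<And>f\<^sub>1 g\<^sub>1 f\<^sub>2 g\<^sub>2. g\<^sub>1 \<noteq> 0 \<Longrightarrow> g\<^sub>2 \<noteq> 0 \<Longrightarrow> frac_rep (f\<^sub>1, g\<^sub>1) = frac_rep (f, g) \<Longrightarrow>
      frac_rep (f\<^sub>2, g\<^sub>2) = frac_rep (f', g') \<Longrightarrow> H f\<^sub>1 g\<^sub>1 f\<^sub>2 g\<^sub>2 = Z"
  shows "(\<Union>(f\<^sub>1, g\<^sub>1)\<in>quot \<iota> \<sigma> n f g. \<Union>(f\<^sub>2, g\<^sub>2)\<in>quot \<iota> \<sigma> n f' g'. H f\<^sub>1 g\<^sub>1 f\<^sub>2 g\<^sub>2) = Z"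
proof -
  have "(f, g) \<in> quot \<iota> \<sigma> n f g" "(f', g') \<in> quot \<iota> \<sigma> n f' g'"
    using assms by (simp_all add: quot_eq_fibre fibre_def)
  moreover have "H f\<^sub>1 g\<^sub>1 f\<^sub>2 g\<^sub>2 = Z" if "(f\<^sub>1, g\<^sub>1) \<in> quot \<iota> \<sigma> n f g" "(f\<^sub>2, g\<^sub>2) \<in> quot \<iota> \<sigma> n f' g'" for f\<^sub>1 g\<^sub>1 f\<^sub>2 g\<^sub>2
    using that assms by (auto simp: quot_eq_fibre fibre_def)
  ultimately show ?thesis by fast
qed

section \<open>Operations on fractions\<close>

lemma mult_A:
  assumes "g \<noteq> 0" "g' \<noteq> 0"
  shows "quot \<iota> \<sigma> n f g \<otimes>\<^bsub>A\<^esub> quot \<iota> \<sigma> n f' g' = quot \<iota> \<sigma> n (skew_mult \<sigma> f f') (g * g')"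
  unfolding central_quotients_def monoid.simps
  by (rule union_over_fibres[OF assms]) (use assms in \<open>auto simp: quot_eq_fibre frac_rep_mult\<close>)

lemma add_A:
  assumes "g \<noteq> 0" "g' \<noteq> 0"
  shows "quot \<iota> \<sigma> n f g \<oplus>\<^bsub>A\<^esub> quot \<iota> \<sigma> n f' g'
    = quot \<iota> \<sigma> n (skew_mult \<sigma> f (center_emb \<iota> n g') + skew_mult \<sigma> f' (center_emb \<iota> n g)) (g * g')"
  unfolding central_quotients_def ring.simps
  by (rule union_over_fibres[OF assms]) (use assms in \<open>auto simp: quot_eq_fibre frac_rep_add\<close>)

lemma quot_in_carrier: "g \<noteq> 0 \<Longrightarrow> quot \<iota> \<sigma> n f g \<in> carrier A"
  by (auto simp: carrier_A)

lemma closed_A: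
  assumes "P \<in> carrier A" "Q \<in> carrier A"
  shows "P \<otimes>\<^bsub>A\<^esub> Q \<in> carrier A" "P \<oplus>\<^bsub>A\<^esub> Q \<in> carrier A"
    "fraction_rep (P \<otimes>\<^bsub>A\<^esub> Q) = fraction_rep P * fraction_rep Q"
    "fraction_rep (P \<oplus>\<^bsub>A\<^esub> Q) = fraction_rep P + fraction_rep Q"
proof -
  obtain f g f' g' where "P = quot \<iota> \<sigma> n f g" "g \<noteq> 0" "Q = quot \<iota> \<sigma> n f' g'" "g' \<noteq> 0"
    using assms by (auto simp: carrier_A)
  then show "P \<otimes>\<^bsub>A\<^esub> Q \<in> carrier A" "P \<oplus>\<^bsub>A\<^esub> Q \<in> carrier A"
    "fraction_rep (P \<otimes>\<^bsub>A\<^esub> Q) = fraction_rep P * fraction_rep Q"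
    "fraction_rep (P \<oplus>\<^bsub>A\<^esub> Q) = fraction_rep P + fraction_rep Q"
    by (simp_all add: mult_A add_A quot_in_carrier fraction_rep_quot frac_rep_mult frac_rep_add)
qed

lemma zero_one_A:
  "\<zero>\<^bsub>A\<^esub> \<in> carrier A" "fraction_rep \<zero>\<^bsub>A\<^esub> = 0\<^sub>m n n"
  "\<one>\<^bsub>A\<^esub> \<in> carrier A" "fraction_rep \<one>\<^bsub>A\<^esub> = 1\<^sub>m n"
proof -
  have "\<zero>\<^bsub>A\<^esub> = quot \<iota> \<sigma> n 0 1" "\<one>\<^bsub>A\<^esub> = quot \<iota> \<sigma> n 1 1"
    by (simp_all add: central_quotients_def)
  then show "\<zero>\<^bsub>A\<^esub> \<in> carrier A" "fraction_rep \<zero>\<^bsub>A\<^esub> = 0\<^sub>m n n"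
    "\<one>\<^bsub>A\<^esub> \<in> carrier A" "fraction_rep \<one>\<^bsub>A\<^esub> = 1\<^sub>m n"
    by (simp_all add: quot_in_carrier fraction_rep_quot) (auto simp: frac_rep_def rep_0 rep_1)
qed

text \<open>All ways of writing \<open>c\<close> as a fraction give the same scalar matrix, so the
  union in \<open>quot_scalar\<close> is a single class.\<close>

lemma scalar:
  shows "quot_scalar \<iota> \<sigma> n c \<in> carrier A"
    and "fraction_rep (quot_scalar \<iota> \<sigma> n c) = to_ac c \<cdot>\<^sub>m 1\<^sub>m n"
proof -
  obtain p g where pg: "c = Fract p g" "g \<noteq> 0" by (rule Fract_cases)
  have rep: "frac_rep (center_emb \<iota> n p', g') = to_ac c \<cdot>\<^sub>m 1\<^sub>m n" if "c = Fract p' g'" "g' \<noteq> 0" for p' g'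
  proof -
    have "to_fract p' = c * to_fract g'" using that by (simp add: Fract_conv_to_fract)
    then have "emb p' = to_ac c * emb g'" by (metis to_ac_mult)
    then show ?thesis
      using that unfolding frac_rep_def by (intro eq_matI) (auto simp: rep_center field_simps)
  qed
  have "quot_scalar \<iota> \<sigma> n c = quot \<iota> \<sigma> n (center_emb \<iota> n p) g"
  proof -
    have "quot \<iota> \<sigma> n (center_emb \<iota> n p') g' = quot \<iota> \<sigma> n (center_emb \<iota> n p) g" if "c = Fract p' g'" "g' \<noteq> 0" for p' g'
      using rep[OF that] rep[OF pg] pg that by (simp add: quot_eq_fibre)
    then show ?thesis unfolding quot_scalar_def using pg by blast
  qed
  then show "quot_scalar \<iota> \<sigma> n c \<in> carrier A" "fraction_rep (quot_scalar \<iota> \<sigma> n c) = to_ac c \<cdot>\<^sub>m 1\<^sub>m n"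
    using pg rep[OF pg] by (simp_all add: quot_in_carrier fraction_rep_quot)
qed

lemma fraction_rep_hom:
  "fraction_rep \<in> Ring.ring_hom A (ring_mat TYPE('f poly fract alg_closure) n ())"
  by (rule ring_hom_memI) (simp_all add: ring_mat_simps fraction_rep_carrier closed_A zero_one_A)

lemma abelian_monoid_A: "abelian_monoid A"
proof (rule abelian_monoidI)
  fix P Q R assume "P \<in> carrier A" "Q \<in> carrier A" "R \<in> carrier A"
  note c = this this[THEN fraction_rep_carrier]
  show "P \<oplus>\<^bsub>A\<^esub> Q \<oplus>\<^bsub>A\<^esub> R = P \<oplus>\<^bsub>A\<^esub> (Q \<oplus>\<^bsub>A\<^esub> R)"
    by (rule fraction_rep_inject) (use c in \<open>simp_all add: closed_A assoc_add_mat[of _ n n]\<close>)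
next
  fix P Q assume "P \<in> carrier A" "Q \<in> carrier A"
  note c = this this[THEN fraction_rep_carrier]
  show "P \<oplus>\<^bsub>A\<^esub> Q = Q \<oplus>\<^bsub>A\<^esub> P"
    by (rule fraction_rep_inject) (use c in \<open>simp_all add: closed_A comm_add_mat[of _ n n]\<close>)
next
  fix P assume "P \<in> carrier A"
  note c = this this[THEN fraction_rep_carrier]
  show "\<zero>\<^bsub>A\<^esub> \<oplus>\<^bsub>A\<^esub> P = P"
    by (rule fraction_rep_inject) (use c in \<open>simp_all add: closed_A zero_one_A\<close>)
qed (simp_all add: closed_A zero_one_A)

sublocale algebra_to_matrices A "quot_scalar \<iota> \<sigma> n" n
  by (intro algebra_to_matrices.intro abelian_monoid_A, unfold_locales)
    (simp_all add: n_pos closed_A zero_one_A scalar)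

section \<open>A basis over F(x) and the splitting\<close>

definition basis_elem :: "nat \<times> nat \<Rightarrow> ('k poly \<times> 'f poly) set" where
  "basis_elem ij = quot \<iota> \<sigma> n (basis_monom ij) 1"

lemma fraction_rep_basis_elem: "fraction_rep (basis_elem ij) = rep (basis_monom ij)"
  by (simp only: basis_elem_def fraction_rep_quot one_neq_zero not_False_eq_True frac_rep_one)

text \<open>\<open>splitting\<close> asks for a set as basis, so the indexed family must have no
  repetitions; \<open>coord\<close> recovers the index through indicator coefficients.\<close>

lemma inj_basis_elem: "inj_on basis_elem idx"
proof (rule inj_onI)
  fix u v assume uv: "u \<in> idx" "v \<in> idx" "basis_elem u = basis_elem v"
  let ?lc = "\<lambda>w. lincomb n idx (\<lambda>z. if z = w then 1 else 0) (\<lambda>ij. rep (basis_monom ij))"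
  have lc: "?lc w = rep (basis_monom w)" if "w \<in> idx" for w
  proof (rule eq_matI)
    fix p q assume "p < dim_row (rep (basis_monom w))" "q < dim_col (rep (basis_monom w))"
    then have "p < n" "q < n" by simp_all
    moreover have "(\<Sum>z\<in>idx. (if z = w then 1 else 0) * rep (basis_monom z) $$ (p, q))
        = (\<Sum>z\<in>idx. if z = w then rep (basis_monom w) $$ (p, q) else 0)"
      by (rule sum.cong) auto
    ultimately show "?lc w $$ (p, q) = rep (basis_monom w) $$ (p, q)" using that by simp
  qed simp_all
  have "rep (basis_monom u) = rep (basis_monom v)"
    using arg_cong[OF uv(3), of fraction_rep] by (simp only: fraction_rep_basis_elem)
  then have "?lc u = ?lc v" by (simp only: lc[OF uv(1)] lc[OF uv(2)])
  then have "coord (?lc u) v = coord (?lc v) v" by simp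
  then show "u = v" unfolding coord_lincomb[OF uv(2)] by (simp split: if_splits)
qed

definition basis_set :: "('k poly \<times> 'f poly) set set" where
  "basis_set = basis_elem ` idx"

abbreviation index_of :: "('k poly \<times> 'f poly) set \<Rightarrow> nat \<times> nat" where
  "index_of \<equiv> the_inv_into idx basis_elem"

lemma basis_set: "finite basis_set" "basis_set \<subseteq> carrier A"
  by (auto simp: basis_set_def basis_elem_def quot_in_carrier)

lemma lincomb_basis_set:
  "lincomb n basis_set c fraction_rep = lincomb n idx (\<lambda>ij. c (basis_elem ij)) (\<lambda>ij. rep (basis_monom ij))"
  unfolding lincomb_def basis_set_def
  by (subst sum.reindex[OF inj_basis_elem]) (simp add: fraction_rep_basis_elem)

lemma matrix_basis:
  assumes U: "U \<in> carrier_mat n n"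
  shows "\<exists>!c. c \<in> basis_set \<rightarrow>\<^sub>E UNIV \<and> U = lincomb n basis_set c fraction_rep"
proof (rule ex1I)
  let ?c = "restrict (\<lambda>v. coord U (index_of v)) basis_set"
  have "lincomb n basis_set ?c fraction_rep = lincomb n idx (coord U) (\<lambda>ij. rep (basis_monom ij))"
    unfolding lincomb_basis_set
    by (rule lincomb_cong) (auto simp: basis_set_def the_inv_into_f_f[OF inj_basis_elem])
  then show "?c \<in> basis_set \<rightarrow>\<^sub>E UNIV \<and> U = lincomb n basis_set ?c fraction_rep"
    by (simp add: lincomb_coord[OF U])
next
  fix c assume c: "c \<in> basis_set \<rightarrow>\<^sub>E UNIV \<and> U = lincomb n basis_set c fraction_rep"
  show "c = restrict (\<lambda>v. coord U (index_of v)) basis_set"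
  proof (rule PiE_ext)
    show "c \<in> basis_set \<rightarrow>\<^sub>E UNIV" using c by simp
    fix v assume "v \<in> basis_set"
    then obtain ij where ij: "ij \<in> idx" "v = basis_elem ij" by (auto simp: basis_set_def)
    have "coord U ij = c v"
      using c ij coord_lincomb[OF ij(1), of "\<lambda>ij. c (basis_elem ij)"] by (simp add: lincomb_basis_set)
    then show "c v = restrict (\<lambda>v. coord U (index_of v)) basis_set v"
      using ij \<open>v \<in> basis_set\<close> by (simp add: the_inv_into_f_f[OF inj_basis_elem])
  qed simp
qed

text \<open>The coordinates of \<open>f/g\<close> are the fractions \<open>part f ij / g\<close>.
  Uniqueness is read off in the matrices: \<open>coord\<close> extracts each coefficient, and the
  embedding of F(x) into its closure is injective.\<close>

lemma algebra_basis:
  assumes P: "P \<in> carrier A"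
  shows "\<exists>!c. c \<in> basis_set \<rightarrow>\<^sub>E UNIV \<and>
    P = (\<Oplus>\<^bsub>A\<^esub>v\<in>basis_set. quot_scalar \<iota> \<sigma> n (c v) \<otimes>\<^bsub>A\<^esub> v)"
proof -
  let ?S = "\<lambda>c. \<Oplus>\<^bsub>A\<^esub>v\<in>basis_set. quot_scalar \<iota> \<sigma> n (c v) \<otimes>\<^bsub>A\<^esub> v"
  have rep_S: "fraction_rep (?S c) = lincomb n basis_set (\<lambda>v. to_ac (c v)) fraction_rep" for c
    by (rule hom_combination[OF fraction_rep_hom scalar(2) basis_set])
  have S: "?S c \<in> carrier A" for c
    by (rule finsum_closed) (use basis_set(2) in \<open>auto intro!: closed_A scalar\<close>)
  obtain f g where fg: "P = quot \<iota> \<sigma> n f g" "g \<noteq> 0" using P by (auto simp: carrier_A)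
  show ?thesis
  proof (rule ex1I)
    let ?c = "restrict (\<lambda>v. to_fract (part f (index_of v)) / to_fract g) basis_set"
    have "fraction_rep (?S ?c) = lincomb n idx (\<lambda>ij. emb (part f ij) / emb g) (\<lambda>ij. rep (basis_monom ij))"
      unfolding rep_S lincomb_basis_set
      by (rule lincomb_cong) (auto simp: basis_set_def the_inv_into_f_f[OF inj_basis_elem])
    also have "\<dots> = inverse (emb g) \<cdot>\<^sub>m lincomb n idx (\<lambda>ij. emb (part f ij)) (\<lambda>ij. rep (basis_monom ij))"
      by (rule eq_matI) (auto simp: sum_distrib_left field_simps)
    also have "\<dots> = fraction_rep P"
      unfolding rep_decompose[of f, symmetric] using fg by (simp add: fraction_rep_quot) (simp add: frac_rep_def)
    finally have "P = ?S ?c" using fraction_rep_inject[OF P S] by simp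
    then show "?c \<in> basis_set \<rightarrow>\<^sub>E UNIV \<and> P = ?S ?c" by simp
  next
    fix c assume c: "c \<in> basis_set \<rightarrow>\<^sub>E UNIV \<and> P = ?S c"
    show "c = restrict (\<lambda>v. to_fract (part f (index_of v)) / to_fract g) basis_set"
    proof (rule PiE_ext)
      show "c \<in> basis_set \<rightarrow>\<^sub>E UNIV" using c by simp
      fix v assume "v \<in> basis_set"
      then obtain ij where ij: "ij \<in> idx" "v = basis_elem ij" by (auto simp: basis_set_def)
      have "fraction_rep P = inverse (emb g) \<cdot>\<^sub>m lincomb n idx (\<lambda>ij. emb (part f ij)) (\<lambda>ij. rep (basis_monom ij))"
        unfolding rep_decompose[of f, symmetric] using fg by (simp add: fraction_rep_quot) (simp add: frac_rep_def)
      also have "\<dots> = lincomb n idx (\<lambda>ij. emb (part f ij) / emb g) (\<lambda>ij. rep (basis_monom ij))"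
        by (rule eq_matI) (auto simp: sum_distrib_left field_simps)
      finally have "coord (fraction_rep P) ij = to_ac (to_fract (part f ij) / to_fract g)"
        using coord_lincomb[OF ij(1)] by simp
      moreover have "coord (fraction_rep P) ij = to_ac (c v)"
      proof -
        have "fraction_rep P = lincomb n idx (\<lambda>ij. to_ac (c (basis_elem ij))) (\<lambda>ij. rep (basis_monom ij))"
          using c rep_S[of c] by (simp add: lincomb_basis_set)
        then show ?thesis using coord_lincomb[OF ij(1)] ij(2) by simp
      qed
      ultimately have "c v = to_fract (part f ij) / to_fract g" by (metis to_ac_eq_iff)
      then show "c v = restrict (\<lambda>v. to_fract (part f (index_of v)) / to_fract g) basis_set v"
        using ij \<open>v \<in> basis_set\<close> by (simp add: the_inv_into_f_f[OF inj_basis_elem])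
    qed simp
  qed
qed

lemma splitting_fraction_rep: "splitting A (quot_scalar \<iota> \<sigma> n) n fraction_rep"
proof -
  let ?M = "ring_mat TYPE('f poly fract alg_closure) n ()"
  have combination: "(\<Oplus>\<^bsub>?M\<^esub>v\<in>basis_set. c v \<cdot>\<^sub>m fraction_rep v) = lincomb n basis_set c fraction_rep" for c
    using basis_set by (intro finsum_ring_mat) (auto intro: fraction_rep_carrier)
  show ?thesis
    unfolding splitting_def Let_def
  proof (intro conjI allI exI[of _ basis_set] ballI)
    fix U assume "U \<in> carrier ?M"
    then have "U \<in> carrier_mat n n" by (simp only: ring_mat_simps)
    then show "\<exists>!c. c \<in> basis_set \<rightarrow>\<^sub>E UNIV \<and> U = (\<Oplus>\<^bsub>?M\<^esub>v\<in>basis_set. c v \<cdot>\<^sub>m fraction_rep v)"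
      unfolding combination by (rule matrix_basis)
  qed (fact fraction_rep_hom scalar(2) basis_set algebra_basis)+
qed

text \<open>\<open>fraction_rep\<close> witnesses the description in \<open>reduced_norm\<close>,
  and \<open>splitting_det_unique\<close> compares any other splitting with it.\<close>

lemma reduced_norm_eq:
  assumes "P \<in> carrier A" "det (fraction_rep P) = to_ac c"
  shows "reduced_norm A (quot_scalar \<iota> \<sigma> n) n P = c"
  unfolding reduced_norm_def
proof (rule the_equality)
  show "\<exists>\<phi>. splitting A (quot_scalar \<iota> \<sigma> n) n \<phi> \<and> to_ac c = det (\<phi> P)"
    by (rule exI[of _ fraction_rep]) (simp only: splitting_fraction_rep assms(2))
  fix c' assume "\<exists>\<phi>. splitting A (quot_scalar \<iota> \<sigma> n) n \<phi> \<and> to_ac c' = det (\<phi> P)"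
  then obtain \<phi> where "splitting A (quot_scalar \<iota> \<sigma> n) n \<phi>" "to_ac c' = det (\<phi> P)" by blast
  moreover have "det (\<phi> P) = det (fraction_rep P)"
    by (rule splitting_det_unique[OF calculation(1) fraction_rep_hom scalar(2) assms(1)])
  ultimately have "to_ac c' = to_ac c" using assms(2) by simp
  then show "c' = c" by simp
qed

end

section \<open>The reduced norm of a skew polynomial\<close>

theorem theorem3:
  fixes \<iota> :: "'f::field \<Rightarrow> 'k::field" and \<sigma> :: "'k \<Rightarrow> 'k" and n m :: nat
    and f :: "'k poly"
  assumes "cyclic_galois_extension \<iota> \<sigma> n"
    and "f \<noteq> 0" and "degree f = m"
  shows "\<exists>p :: 'f poly.
      reduced_norm (central_quotients \<iota> \<sigma> n) (quot_scalar \<iota> \<sigma> n) n (quot \<iota> \<sigma> n f 1) = to_fract p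
    \<and> degree p = m
    \<and> coeff p 0 = field_norm \<iota> (coeff f 0)
    \<and> coeff p m = (- 1) ^ (m * (n - 1)) * field_norm \<iota> (coeff f m)"
proof -
  obtain b crd W where "cyclic_data \<iota> \<sigma> n b crd W"
    by (rule cyclic_galois_cyclic_data[OF assms(1)])
  then interpret cyclic_data \<iota> \<sigma> n b crd W .
  obtain p where p: "det (rep f) = emb p" "degree p = degree f"
    "coeff p 0 = field_norm \<iota> (coeff f 0)"
    "coeff p (degree f) = (-1) ^ (degree f * (n - 1)) * field_norm \<iota> (coeff f (degree f))"
    by (rule det_rep[OF assms(2)])
  have "fraction_rep (quot \<iota> \<sigma> n f 1) = rep f"
    by (simp only: fraction_rep_quot one_neq_zero not_False_eq_True frac_rep_one)
  then have "reduced_norm A (quot_scalar \<iota> \<sigma> n) n (quot \<iota> \<sigma> n f 1) = to_fract p"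
    using p(1) by (intro reduced_norm_eq) (simp_all add: quot_in_carrier)
  then show ?thesis using p assms(3) by auto
qed

end
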